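(* Let $m$ be a positive integer with $m\equiv 1\pmod 6$. Let $e=\frac{3^{\frac{m+2}{3}}+5}{2}$. Then the ternary cyclic code $\mathcal{C}_{(1,e)}$ has parameters $[3^m-1,\ 3^m-1-2m,\ 4]$ and is optimal.
   Context: Let $\mathbb{F}_{3^m}$ be the finite field with $3^m$ elements, and $\alpha$ a generator of the multiplicative group $\mathbb{F}_{3^m}^*$. For an integer $i$, $m_{\alpha^i}(x)$ denotes the minimal polynomial of $\alpha^i$ over $\mathbb{F}_3$. An $[n,k,d]$ linear code over $\mathbb{F}_3$ is a $k$-dimensional subspace of $\mathbb{F}_3^n$ with minimum Hamming distance $d$. A ternary cyclic code of length $n$ (with $\gcd(n,3)=1$) is identified with an ideal of $\mathbb{F}_3[x]/(x^n-1)$ via $(c_0,\dots,c_{n-1})\mapsto c_0+c_1x+\cdots+c_{n-1}x^{n-1}$; its generator polynomial is the monic polynomial of least degree generating the ideal. $\mathcal{C}_{(i_1,i_2,\dots,i_t)}$ denotes the ternary cyclic code of length $3^m-1$ with generator polynomial $m_{\alpha^{i_1}}(x)m_{\alpha^{i_2}}(x)\cdots m_{\alpha^{i_t}}(x)$. A ternary $[n,k,d]$ code is optimal (in the standard sense) if no linear code over $\mathbb{F}_3$ of length $n$ and dimension $k$ has minimum distance larger than $d$.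
   Formalization: The case m = 1 is excluded: there the length is 2, e = 4 and the generator polynomial is x^2 - 1, so the code is the zero code and cannot have minimum distance 4; the theorem is stated for m > 1 with m ≡ 1 (mod 6). *)

theory Defs
  imports
    "HOL-Library.Cardinality"
    "HOL-Number_Theory.Cong"
    "Jordan_Normal_Form.VS_Connect"
begin

definition hamming_dist :: "'k vec \<Rightarrow> 'k vec \<Rightarrow> nat" where
  "hamming_dist u v = card {i. i < dim_vec u \<and> u $ i \<noteq> v $ i}"

(* A relation rather than a function, so that a code with fewer than two
   words has no minimum distance at all. *)
definition has_min_dist :: "'k vec set \<Rightarrow> nat \<Rightarrow> bool" where
  "has_min_dist C d \<longleftrightarrow>
     (\<exists>u\<in>C. \<exists>v\<in>C. u \<noteq> v \<and> hamming_dist u v = d) \<and>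
     (\<forall>u\<in>C. \<forall>v\<in>C. u \<noteq> v \<longrightarrow> d \<le> hamming_dist u v)"

definition linear_code :: "nat \<Rightarrow> nat \<Rightarrow> nat \<Rightarrow> 'k::field vec set \<Rightarrow> bool" where
  "linear_code n k d C \<longleftrightarrow>
     subspace class_ring C (module_vec TYPE('k) n) \<and>
     vectorspace.dim class_ring ((module_vec TYPE('k) n)\<lparr>carrier := C\<rparr>) = k \<and>
     has_min_dist C d"

definition optimal_code :: "nat \<Rightarrow> nat \<Rightarrow> nat \<Rightarrow> 'k::field vec set \<Rightarrow> bool" where
  "optimal_code n k d C \<longleftrightarrow>
     linear_code n k d C \<and>
     \<not> (\<exists>(C' :: 'k vec set) d'. linear_code n k d' C' \<and> d < d')"

definition vec_poly :: "'k::field vec \<Rightarrow> 'k poly" where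
  "vec_poly c = (\<Sum>i<dim_vec c. monom (c $ i) i)"

(* The ideal of K[x]/(x^n - 1) generated by the class of g, read as a set of
   words of length n. *)
definition principal_cyclic_code :: "nat \<Rightarrow> 'k::field poly \<Rightarrow> 'k vec set" where
  "principal_cyclic_code n g =
     {c \<in> carrier_vec n. \<exists>a. [vec_poly c = a * g] (mod (monom 1 n - 1))}"

definition is_generator_poly :: "nat \<Rightarrow> 'k::field vec set \<Rightarrow> 'k poly \<Rightarrow> bool" where
  "is_generator_poly n C g \<longleftrightarrow>
     lead_coeff g = 1 \<and> C = principal_cyclic_code n g \<and>
     (\<forall>h. lead_coeff h = 1 \<and> C = principal_cyclic_code n h \<longrightarrow> degree g \<le> degree h)"

(* Not every monic g is a generator polynomial: that requires g to divide
   x^n - 1, and otherwise no such code exists. *)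
definition cyclic_code :: "nat \<Rightarrow> 'k::field poly \<Rightarrow> 'k vec set" where
  "cyclic_code n g = (THE C. is_generator_poly n C g)"

definition is_min_poly :: "('k::field \<Rightarrow> 'f::field) \<Rightarrow> 'f \<Rightarrow> 'k poly \<Rightarrow> bool" where
  "is_min_poly \<iota> x p \<longleftrightarrow>
     lead_coeff p = 1 \<and> poly (map_poly \<iota> p) x = 0 \<and>
     (\<forall>q. lead_coeff q = 1 \<and> poly (map_poly \<iota> q) x = 0 \<longrightarrow> degree p \<le> degree q)"

(* The minimal polynomial of x over 'k, where 'f is an extension of 'k via the
   embedding \<iota>. *)
definition min_poly :: "('k::field \<Rightarrow> 'f::field) \<Rightarrow> 'f \<Rightarrow> 'k poly" where
  "min_poly \<iota> x = (THE p. is_min_poly \<iota> x p)"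

(* For a finite field the nonnegative powers already exhaust the cyclic group
   generated by a nonzero element. *)
definition generates_units :: "'f::field \<Rightarrow> bool" where
  "generates_units \<alpha> \<longleftrightarrow> range (\<lambda>i::nat. \<alpha> ^ i) = UNIV - {0}"

definition exponent_code ::
    "('k::field \<Rightarrow> 'f::field) \<Rightarrow> 'f \<Rightarrow> nat \<Rightarrow> nat list \<Rightarrow> 'k vec set" where
  "exponent_code \<iota> \<alpha> m es =
     cyclic_code (3 ^ m - 1) (\<Prod>i\<leftarrow>es. min_poly \<iota> (\<alpha> ^ i))"

end

theory Submission
  imports Defs "Jordan_Normal_Form.Char_Poly"
begin

text \<open>
  A word of weight at most three in the code amounts, by evenness of \<open>e\<close>, to nonzero \<open>a, b, c\<close> with
  \<open>a + b + c = 0\<close> and \<open>a\<^sup>e + b\<^sup>e = \<plusminus> c\<^sup>e\<close>.  Put \<open>q = 3\<^sup>h\<close> with \<open>h = (m + 2) / 3\<close>, so that \<open>2 e = q + 5\<close>.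
  Squaring away the signs and writing the progression \<open>a, b, c\<close> as multiples of \<open>y, y + 1, y - 1\<close>
  turns the condition into \<open>(y\<^sup>q - y) (1 - g\<^sup>2) = g\<^sup>3\<close> with \<open>g = y\<^sup>3 - y\<close>.  For \<open>k = 1 / g\<close> and \<open>s = k\<^sup>2 - 1\<close>
  this reads \<open>k\<^sup>q = k\<^sup>3 s\<^sup>3 / (s\<^sup>2 + 1)\<^sup>2\<close>.  As \<open>q\<^sup>3 = 9 * 3\<^sup>m\<close>, applying \<open>x \<mapsto> x\<^sup>q\<close> three times is
  \<open>x \<mapsto> x\<^sup>9\<close>, which makes \<open>s\<close> a root of a polynomial of degree 121 over the prime field.  This polynomial
  is \<open>(X\<^sup>2 + (s + 1) Y\<^sup>2) (A\<^sup>2 + B\<^sup>2)\<close> with \<open>X, Y\<close> coprime and \<open>A, B\<close> coprime; since \<open>s + 1 = k\<^sup>2\<close> and \<open>- 1\<close> is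
  not a square for odd \<open>m\<close>, it has no such root.  Hence the minimum distance is at least 4, and sphere packing
  excludes distance 5 for every code of this length and dimension.
\<close>

section \<open>Polynomials over the field with three elements as lists\<close>

text \<open>Lists over this type are polynomials over the prime field, constant term first. A
  concrete datatype lets \<open>code_simp\<close> check identities of degree beyond one hundred, and
  \<open>val3\<close> carries them into any commutative ring with 3 = 0.\<close>

datatype trit = T0 | T1 | T2

fun trit_add :: "trit \<Rightarrow> trit \<Rightarrow> trit" where
  "trit_add T0 b = b"
| "trit_add T1 T0 = T1" | "trit_add T1 T1 = T2" | "trit_add T1 T2 = T0"
| "trit_add T2 T0 = T2" | "trit_add T2 T1 = T0" | "trit_add T2 T2 = T1"

fun trit_neg :: "trit \<Rightarrow> trit" where
  "trit_neg T0 = T0" | "trit_neg T1 = T2" | "trit_neg T2 = T1"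

fun add3 :: "trit list \<Rightarrow> trit list \<Rightarrow> trit list" where
  "add3 [] q = q"
| "add3 p [] = p"
| "add3 (a # p) (b # q) = trit_add a b # add3 p q"

definition neg3 :: "trit list \<Rightarrow> trit list" where
  "neg3 p = map trit_neg p"

definition sub3 :: "trit list \<Rightarrow> trit list \<Rightarrow> trit list" where
  "sub3 p q = add3 p (neg3 q)"

fun mul3 :: "trit list \<Rightarrow> trit list \<Rightarrow> trit list" where
  "mul3 [] q = []"
| "mul3 (T0 # p) q = T0 # mul3 p q"
| "mul3 (T1 # p) q = add3 q (T0 # mul3 p q)"
| "mul3 (T2 # p) q = add3 (neg3 q) (T0 # mul3 p q)"

fun pow3 :: "trit list \<Rightarrow> nat \<Rightarrow> trit list" where
  "pow3 p 0 = [T1]"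
| "pow3 p (Suc j) = mul3 p (pow3 p j)"

fun trit_val :: "trit \<Rightarrow> 'a::comm_ring_1" where
  "trit_val T0 = 0" | "trit_val T1 = 1" | "trit_val T2 = - 1"

fun val3 :: "trit list \<Rightarrow> 'a::comm_ring_1 \<Rightarrow> 'a" where
  "val3 [] x = 0"
| "val3 (a # p) x = trit_val a + x * val3 p x"

text \<open>Trailing zeros are allowed in a list, so an identity is tested by the vanishing of a
  difference and not by equality of lists.\<close>

definition vanishing3 :: "trit list \<Rightarrow> bool" where
  "vanishing3 p \<longleftrightarrow> list_all (\<lambda>a. a = T0) p"

context
  assumes char_3: "(3 :: 'a::comm_ring_1) = 0"
begin

lemma trit_val_add: "trit_val (trit_add a b) = (trit_val a + trit_val b :: 'a)"
proof -
  have "(1 :: 'a) + 1 = - 1" "- 1 - 1 = (1::'a)"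
    using char_3 by (simp_all add: eq_neg_iff_add_eq_0 algebra_simps)
  then show ?thesis by (cases a; cases b) auto
qed

lemma val3_add: "val3 (add3 p q) x = (val3 p x + val3 q x :: 'a)"
  by (induction p q rule: add3.induct) (auto simp: trit_val_add algebra_simps)

lemma val3_neg: "val3 (neg3 p) x = (- val3 p x :: 'a)"
proof -
  have "trit_val (trit_neg a) = (- trit_val a :: 'a)" for a by (cases a) auto
  then show ?thesis unfolding neg3_def by (induction p) (auto simp: algebra_simps)
qed

lemma val3_sub: "val3 (sub3 p q) x = (val3 p x - val3 q x :: 'a)"
  by (simp add: sub3_def val3_add val3_neg)

lemma val3_mul: "val3 (mul3 p q) x = (val3 p x * val3 q x :: 'a)"
  by (induction p q rule: mul3.induct) (auto simp: val3_add val3_neg algebra_simps)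

lemma val3_pow: "val3 (pow3 p j) x = (val3 p x ^ j :: 'a)"
  by (induction j) (auto simp: val3_mul)

lemma val3_vanishing: "vanishing3 p \<Longrightarrow> val3 p x = (0 :: 'a)"
  unfolding vanishing3_def by (induction p) auto

lemmas val3_hom = val3_add val3_sub val3_mul val3_pow

end

section \<open>A certificate for the absence of roots\<close>

text \<open>The polynomials \<open>X\<close>, \<open>Y\<close>, \<open>A\<close>, \<open>B\<close> below come from a factorization of the eliminant by
  computer: modulo each irreducible factor of degree 7 the element \<open>- (s + 1)\<close> is a square, modulo all other
  irreducible factors (degrees 2, 8, 8, 82) it is \<open>- 1\<close> that is a square.  The remaining four are
  Bezout coefficients.\<close>

definition cert_X :: "trit list" where
  "cert_X =
    [T1, T0, T1, T0, T2, T2, T1, T0, T0, T1, T2]"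

definition cert_Y :: "trit list" where
  "cert_Y =
    [T0, T1, T2, T2, T1, T0, T1, T2, T2, T0, T1]"

definition cert_XU :: "trit list" where
  "cert_XU =
    [T1, T2, T1, T2, T1, T2, T2, T2]"

definition cert_YV :: "trit list" where
  "cert_YV =
    [T1, T2, T2, T2, T1, T2, T0, T2]"

definition cert_A :: "trit list" where
  "cert_A =
    [T2, T1, T2, T0, T2, T2, T0, T2, T0, T0, T1, T0, T1, T2, T1, T0, T2, T1, T1, T1, T2, T1, T2, T0, T0, T1, T2, T0, T1, T1,
     T1, T2, T1, T2, T1, T2, T2, T2, T0, T0, T1, T0, T0, T0, T0, T2, T0, T0, T1, T2, T2]"

definition cert_B :: "trit list" where
  "cert_B =
    [T1, T1, T1, T1, T1, T0, T0, T2, T2, T0, T1, T2, T2, T2, T2, T1, T1, T2, T2, T2, T2, T0, T2, T1, T1, T1, T1, T1, T1, T2,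
     T0, T2, T1, T1, T2, T1, T2, T0, T1, T2, T0, T2, T2, T1, T0, T1, T2, T0, T0, T1]"

definition cert_AU :: "trit list" where
  "cert_AU =
    [T2, T0, T1, T2, T1, T0, T0, T2, T2, T2, T0, T2, T2, T2, T1, T2, T2, T2, T0, T2, T2, T1, T0, T0, T1, T0, T2, T0, T1, T1,
     T0, T1, T0, T0, T2, T2, T1, T0, T2, T0, T1, T2, T0, T0, T2, T2, T1]"

definition cert_BV :: "trit list" where
  "cert_BV =
    [T0, T1, T2, T1, T1, T1, T0, T1, T1, T1, T0, T2, T1, T2, T0, T1, T2, T2, T1, T1, T2, T0, T1, T1, T1, T2, T0, T1, T2, T0,
     T2, T0, T0, T2, T1, T0, T0, T1, T0, T2, T1, T2, T0, T0, T1, T0, T0, T1]"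

text \<open>With \<open>n = s\<^sup>2 + 1\<close>, these are \<open>s\<^sup>q n\<^sup>4\<close> (\<open>t3\<close>), \<open>((s\<^sup>q)\<^sup>2 + 1) n\<^sup>8\<close> (\<open>v3\<close>) and
  \<open>(s\<^sup>q)\<^sup>q n\<^sup>4 v\<^sup>4\<close> (\<open>m3\<close>) as polynomials in \<open>s\<close>; see the derivation of \<open>elim3_root\<close>.\<close>

definition lin3 :: "trit list" where "lin3 = [T0, T1]"
definition n3 :: "trit list" where "n3 = [T1, T0, T1]"
definition t3 :: "trit list" where "t3 = [T2, T0, T2, T0, T0, T0, T0, T0, T2, T1]"
definition v3 :: "trit list" where "v3 = add3 (pow3 t3 2) (pow3 n3 8)"
definition m3 :: "trit list" where
  "m3 = sub3 (sub3 (sub3 (pow3 (pow3 t3 3) 3) (mul3 (pow3 t3 8) (pow3 n3 4)))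
     (mul3 (pow3 t3 2) (pow3 n3 28))) (pow3 n3 36)"
definition l3 :: "trit list" where
  "l3 = sub3 (mul3 [T0, T0, T2, T1, T1] t3) (pow3 n3 6)"
definition elim3 :: "trit list" where
  "elim3 = sub3 (mul3 (mul3 l3 (mul3 (pow3 [T1, T1] 3) (pow3 lin3 6))) (mul3 (pow3 t3 2) m3))
     (mul3 (pow3 n3 6) (pow3 (pow3 v3 2) 3))"

text \<open>The two factors are norms: the first from the extension by a square root of -(s + 1),
  the second from the extension by a square root of -1.\<close>

lemma elim3_factorization:
  "vanishing3 (sub3 elim3 (mul3 (add3 (pow3 cert_X 2) (mul3 [T1, T1] (pow3 cert_Y 2)))
     (add3 (pow3 cert_A 2) (pow3 cert_B 2))))"
  by code_simp

lemma bezout_XY: "vanishing3 (sub3 (add3 (mul3 cert_XU cert_X) (mul3 cert_YV cert_Y)) [T1])"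
  by code_simp

lemma bezout_AB: "vanishing3 (sub3 (add3 (mul3 cert_AU cert_A) (mul3 cert_BV cert_B)) [T1])"
  by code_simp
section \<open>The eliminant\<close>

lemma cube_add_char_3:
  fixes x y :: "'a::comm_ring_1"
  assumes "(3 :: 'a) = 0"
  shows "(x + y) ^ 3 = x ^ 3 + y ^ 3"
proof -
  have "(x + y) ^ 3 = x ^ 3 + y ^ 3 + 3 * (x ^ 2 * y + x * y ^ 2)"
    by (simp add: power2_eq_square power3_eq_cube algebra_simps)
  then show ?thesis using assms by simp
qed

lemma frob_add:
  fixes x y :: "'a::comm_ring_1"
  assumes "(3 :: 'a) = 0"
  shows "(x + y) ^ (3 ^ j) = x ^ (3 ^ j) + y ^ (3 ^ j)"
proof (induction j)
  case (Suc j)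
  have "(x + y) ^ (3 ^ Suc j) = ((x + y) ^ (3 ^ j)) ^ 3"
    by (simp add: power_mult [symmetric] mult.commute)
  also have "\<dots> = (x ^ (3 ^ j)) ^ 3 + (y ^ (3 ^ j)) ^ 3"
    unfolding Suc.IH by (rule cube_add_char_3 [OF assms])
  finally show ?case by (simp add: power_mult [symmetric] mult.commute)
qed simp

lemma frob_diff:
  fixes x y :: "'a::comm_ring_1"
  assumes "(3 :: 'a) = 0"
  shows "(x - y) ^ (3 ^ j) = x ^ (3 ^ j) - y ^ (3 ^ j)"
  using frob_add [OF assms, of "x - y" y j] by (simp add: algebra_simps)

lemma sum_two_squares_eq_0:
  fixes x y :: "'a::field"
  assumes "\<And>z :: 'a. z ^ 2 \<noteq> - 1" and "x ^ 2 + y ^ 2 = 0"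
  shows "x = 0 \<and> y = 0"
proof (cases "y = 0")
  case False
  then have "(x / y) ^ 2 = - 1"
    using assms(2) by (simp add: power_divide eq_neg_iff_add_eq_0 add_divide_distrib [symmetric] field_simps)
  with assms(1) show ?thesis by blast
qed (use assms(2) in auto)

text \<open>Substituting s + 1 = k^2 makes both factors sums of two squares. A root would then be a
  common zero of a coprime pair, where the Bezout identity reads 0 = 1.\<close>

lemma elim3_no_root:
  fixes k s :: "'a::field"
  assumes char_3: "(3 :: 'a) = 0" and nonsquare: "\<And>z :: 'a. z ^ 2 \<noteq> - 1"
    and k: "s + 1 = k ^ 2" "k \<noteq> 0"
  shows "val3 elim3 s \<noteq> 0"
proof
  note hom = val3_hom [OF char_3]
  have bezout: "\<not> (val3 X s = 0 \<and> val3 Y s = 0)"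
    if "vanishing3 (sub3 (add3 (mul3 U X) (mul3 V Y)) [T1])" for U V X Y
    using val3_vanishing [OF char_3 that, of s] by (auto simp: hom)
  assume "val3 elim3 s = 0"
  moreover have "val3 elim3 s = (val3 cert_X s ^ 2 + (k * val3 cert_Y s) ^ 2) *
      (val3 cert_A s ^ 2 + val3 cert_B s ^ 2)"
    using val3_vanishing [OF char_3 elim3_factorization, of s]
    by (simp add: hom power_mult_distrib k(1) [symmetric] algebra_simps)
  ultimately consider "val3 cert_X s ^ 2 + (k * val3 cert_Y s) ^ 2 = 0"
    | "val3 cert_A s ^ 2 + val3 cert_B s ^ 2 = 0" by auto
  then show False
  proof cases
    case 1
    from sum_two_squares_eq_0 [OF nonsquare 1] k(2) bezout [OF bezout_XY]
    show False by simp
  next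
    case 2
    from sum_two_squares_eq_0 [OF nonsquare 2] bezout [OF bezout_AB]
    show False by simp
  qed
qed

text \<open>Here \<open>k\<close>, \<open>k1\<close>, \<open>k2\<close> stand for k and its first
  two images under the q-th power map. The recursions make \<open>s1\<close> and \<open>s2\<close>
  rational functions of \<open>s\<close>; \<open>sum\<close> times k^3 contains \<open>k\<close>
  only through k^2 = s + 1, so clearing denominators leaves a polynomial in
  \<open>s\<close>.\<close>

lemma elim3_root:
  fixes k k1 k2 :: "'a::field"
  assumes char_3: "(3 :: 'a) = 0"
    and s: "s = k ^ 2 - 1" "s1 = k1 ^ 2 - 1" "s2 = k2 ^ 2 - 1"
    and nz: "k \<noteq> 0" "k1 \<noteq> 0" "k2 \<noteq> 0" "s \<noteq> 0" "s1 \<noteq> 0" "s2 \<noteq> 0" "s ^ 2 + 1 \<noteq> 0" "s1 ^ 2 + 1 \<noteq> 0"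
    and k1: "k1 * (s ^ 2 + 1) ^ 2 = k ^ 3 * s ^ 3"
    and k2: "k2 * (s1 ^ 2 + 1) ^ 2 = k1 ^ 3 * s1 ^ 3"
    and sum: "1 / (k * s) + 1 / (k1 * s1) + 1 / (k2 * s2) = 1 / k ^ 3 + 1 / k"
  shows "val3 elim3 s = 0"
proof -
  define n where "n = s ^ 2 + 1"
  define n1 where "n1 = s1 ^ 2 + 1"
  \<comment> \<open>\<open>T\<close> is a function because it serves twice: at \<open>s\<close> for
    the numerator of \<open>s1\<close>, at \<open>s1\<close> for that of \<open>s2\<close>.\<close>
  define T where "T x = x ^ 9 - x ^ 8 - x ^ 2 - 1" for x :: 'a
  define V where "V = T s ^ 2 + n ^ 8"
  define M where "M = T s ^ 9 - T s ^ 8 * n ^ 4 - T s ^ 2 * n ^ 28 - n ^ 36"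
  have T: "(x + 1) ^ 3 * x ^ 6 - (x ^ 2 + 1) ^ 4 = T x" for x :: 'a
  proof -
    have "(x + 1) ^ 3 * x ^ 6 - (x ^ 2 + 1) ^ 4
        = T x + 3 * (x ^ 8 + x ^ 7 - x ^ 6 - 2 * x ^ 4 - x ^ 2)"
      unfolding T_def by (simp add: eval_nat_numeral algebra_simps)
    then show ?thesis using char_3 by simp
  qed
  have step: "s' * (x ^ 2 + 1) ^ 4 = T x"
    if "k' * (x ^ 2 + 1) ^ 2 = l ^ 3 * x ^ 3" "x = l ^ 2 - 1" "s' = k' ^ 2 - 1" for s' k' l x
  proof -
    have "s' * (x ^ 2 + 1) ^ 4 = (k' * (x ^ 2 + 1) ^ 2) ^ 2 - (x ^ 2 + 1) ^ 4"
      unfolding that(3) by Groebner_Basis.algebra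
    also have "\<dots> = (l ^ 2) ^ 3 * x ^ 6 - (x ^ 2 + 1) ^ 4"
      unfolding that(1) by Groebner_Basis.algebra
    also have "l ^ 2 = x + 1" using that(2) by simp
    finally show ?thesis unfolding T .
  qed
  have s1n: "s1 * n ^ 4 = T s" unfolding n_def by (rule step [OF k1 s(1,2)])
  have s2n1: "s2 * n1 ^ 4 = T s1" unfolding n1_def by (rule step [OF k2 s(2,3)])
  have n1n: "n1 * n ^ 8 = V"
    unfolding V_def n1_def s1n [symmetric] by Groebner_Basis.algebra
  have M: "s2 * (n ^ 4 * V ^ 4) = M"
  proof -
    have "s2 * (n ^ 4 * V ^ 4) = (s2 * n1 ^ 4) * n ^ 36"
      unfolding n1n [symmetric] by Groebner_Basis.algebra
    also have "\<dots> = M"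
      unfolding s2n1 M_def s1n [symmetric] unfolding T_def by Groebner_Basis.algebra
    finally show ?thesis .
  qed
  have nz': "n \<noteq> 0" "n1 \<noteq> 0" using nz unfolding n_def n1_def by auto
  \<comment> \<open>\<open>A1\<close> and \<open>A2\<close> write the second and third terms of
    \<open>sum\<close>, times k^3, as fractions in \<open>s\<close> alone.\<close>
  have A1: "k ^ 3 / (k1 * s1) * (s ^ 3 * T s) = n ^ 6"
  proof -
    have "k ^ 3 / (k1 * s1) * (s ^ 3 * T s) = (k ^ 3 * s ^ 3) * (s1 * n ^ 4) / (k1 * s1)"
      unfolding s1n by simp
    also have "\<dots> = n ^ 6"
      unfolding k1 [symmetric] n_def [symmetric] using nz by simp
    finally show ?thesis .
  qed
  have A2: "k ^ 3 / (k2 * s2) * ((s + 1) ^ 3 * s ^ 9 * T s ^ 3 * M) = n ^ 6 * V ^ 6"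
  proof -
    have "(s + 1) ^ 3 = k ^ 6" using s(1) by (simp add: power_mult [symmetric])
    then have "k ^ 3 * ((s + 1) ^ 3 * s ^ 9 * T s ^ 3 * M)
        = (k ^ 3 * s ^ 3) ^ 3 * (s1 * n ^ 4) ^ 3 * (s2 * (n ^ 4 * V ^ 4))"
      unfolding M s1n by Groebner_Basis.algebra
    also have "\<dots> = (k1 ^ 3 * s1 ^ 3) * n ^ 18 * s2 * (n ^ 4 * V ^ 4)"
      unfolding k1 [symmetric] n_def [symmetric] by Groebner_Basis.algebra
    also have "\<dots> = (k2 * s2) * (n ^ 6 * (n1 * n ^ 8) ^ 2 * V ^ 4)"
      unfolding k2 [symmetric] n1_def [symmetric] by Groebner_Basis.algebra
    also have "\<dots> = (k2 * s2) * (n ^ 6 * V ^ 6)"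
      unfolding n1n by Groebner_Basis.algebra
    finally show ?thesis using nz by (simp add: field_simps)
  qed
  have sum': "(k ^ 3 / (k1 * s1) + k ^ 3 / (k2 * s2)) * s = s ^ 2 + s - 1"
  proof -
    have "k ^ 3 / (k1 * s1) + k ^ 3 / (k2 * s2) = k ^ 3 * (1 / k ^ 3 + 1 / k - 1 / (k * s))"
      unfolding sum [symmetric] by (simp add: algebra_simps)
    also have "\<dots> * s = s + k ^ 2 * s - k ^ 2"
      using nz by (simp add: field_simps power2_eq_square power3_eq_cube)
    also have "k ^ 2 = s + 1" using s(1) by simp
    also have "s + (s + 1) * s - (s + 1) = s ^ 2 + s - 1" by Groebner_Basis.algebra
    finally show ?thesis .
  qed
  \<comment> \<open>The common multiplier \<open>(s + 1) ^ 3 * s ^ 9 * T s ^ 3 * M\<close> clears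
    the denominators of \<open>A1\<close> and \<open>A2\<close> together.\<close>
  have "a * (s ^ 3 * T s) * ((s + 1) ^ 3 * s ^ 6 * T s ^ 2 * M)
      + b * ((s + 1) ^ 3 * s ^ 9 * T s ^ 3 * M)
      = (a + b) * s * ((s + 1) ^ 3 * s ^ 8 * T s ^ 3 * M)" for a b :: 'a
    by Groebner_Basis.algebra
  from this [of "k ^ 3 / (k1 * s1)" "k ^ 3 / (k2 * s2)"]
  have "n ^ 6 * ((s + 1) ^ 3 * s ^ 6 * T s ^ 2 * M) + n ^ 6 * V ^ 6
      = (s ^ 2 + s - 1) * ((s + 1) ^ 3 * s ^ 8 * T s ^ 3 * M)"
    unfolding A1 A2 sum' .
  moreover have "val3 elim3 s = ((s ^ 4 + s ^ 3 - s ^ 2) * T s - n ^ 6) * ((s + 1) ^ 3 * s ^ 6) * (T s ^ 2 * M)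
      - n ^ 6 * V ^ 6"
  proof -
    note hom = val3_hom [OF char_3]
    have "val3 n3 s = n" "val3 t3 s = T s" "val3 lin3 s = s"
      by (simp_all add: n3_def n_def t3_def T_def lin3_def power2_eq_square eval_nat_numeral algebra_simps)
    note val = this
    have val': "val3 v3 s = V" "val3 m3 s = M"
      by (simp_all add: v3_def V_def m3_def M_def hom val power_mult [symmetric])
    have val'': "val3 [T1, T1] s = s + 1" "val3 [T0, T0, T2, T1, T1] s = s ^ 4 + s ^ 3 - s ^ 2"
      by (simp_all add: eval_nat_numeral algebra_simps)
    show ?thesis
      unfolding elim3_def l3_def hom val val' val'' by (simp add: power_mult [symmetric])
  qed
  ultimately show ?thesis by Groebner_Basis.algebra
qed

text \<open>The left-hand side is invariant under \<open>(y, Q) \<mapsto> (y + 1, Q + 1)\<close>, so it is a polynomial in the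
  invariants \<open>Q - y\<close> and \<open>g\<close>.\<close>

lemma norm_form_eq:
  fixes Q y g :: "'a::field"
  assumes char_3: "(3 :: 'a) = 0" and g: "g = y ^ 3 - y"
    and X: "X = Q * y ^ 5" and Y: "Y = (Q + 1) * (y + 1) ^ 5" and Z: "Z = (Q - 1) * (y - 1) ^ 5"
  shows "X ^ 2 + Y ^ 2 + Z ^ 2 + X * Y + Y * Z + Z * X
    = (Q - y) * ((Q - y) * (1 - g ^ 2) - g ^ 3)"
proof -
  define D where "D = Q - y"
  have Q: "Q = D + y" unfolding D_def by simp
  have "X + Y + Z = - (D * g + 1) + 3 * (D * y ^ 5 + 7 * D * y ^ 3 + 3 * D * y + y ^ 6
      + 10 * y ^ 4 + 10 * y ^ 2 + 1)"
    unfolding X Y Z Q g by Groebner_Basis.algebra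
  then have sum: "X + Y + Z = - (D * g + 1)" using char_3 by simp
  have "X * Y + Y * Z + Z * X = 2 * D * g * (1 - g ^ 2) - D ^ 2 * (1 + g ^ 2) + 1
      + 3 * (D ^ 2 * y ^ 10 + 5 * D ^ 2 * y ^ 8 + 7 * D ^ 2 * y ^ 6 - 4 * D ^ 2 * y ^ 4
        + 2 * D ^ 2 * y ^ 2 + 2 * D * y ^ 11 + 14 * D * y ^ 9 + 18 * D * y ^ 7 - 4 * D * y ^ 5
        + 2 * D * y ^ 3 + y ^ 12 + 8 * y ^ 10 + 15 * y ^ 8 - 6 * y ^ 6 + 5 * y ^ 4 - 2 * y ^ 2)"
    unfolding X Y Z Q g by Groebner_Basis.algebra
  then have prod: "X * Y + Y * Z + Z * X = 2 * D * g * (1 - g ^ 2) - D ^ 2 * (1 + g ^ 2) + 1"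
    using char_3 by simp
  have "X ^ 2 + Y ^ 2 + Z ^ 2 + X * Y + Y * Z + Z * X
      = (X + Y + Z) ^ 2 - (X * Y + Y * Z + Z * X)"
    by Groebner_Basis.algebra
  also have "\<dots> = D * (D * (1 - g ^ 2) - g ^ 3) + 3 * (D ^ 2 * g ^ 2 + D * g ^ 3)"
    unfolding sum prod by Groebner_Basis.algebra
  finally show ?thesis using char_3 unfolding D_def by simp
qed

text \<open>Since \<open>q\<^sup>3 = 9 * 3\<^sup>m\<close>, the third iterate of \<open>\<phi>\<close> is the square of the Frobenius map, so the
  orbit \<open>k, k1, k2\<close> closes up and telescoping \<open>\<phi> y - y\<close> gives one equation in \<open>s\<close> alone.\<close>

lemma no_frob_point:
  fixes y :: "'a::field"
  assumes char_3: "(3 :: 'a) = 0" and nonsquare: "\<And>z :: 'a. z ^ 2 \<noteq> - 1"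
    and frob_m: "\<And>x :: 'a. x ^ (3 ^ m) = x" and h: "3 * h = m + 2"
    and g: "g = y ^ 3 - y" "g \<noteq> 0" and y: "(y ^ (3 ^ h) - y) * (1 - g ^ 2) = g ^ 3"
  shows False
proof -
  define \<phi> where "\<phi> x = x ^ (3 ^ h)" for x :: 'a
  have \<phi>_add: "\<phi> (x + z) = \<phi> x + \<phi> z" and \<phi>_diff: "\<phi> (x - z) = \<phi> x - \<phi> z"
    and \<phi>_mult: "\<phi> (x * z) = \<phi> x * \<phi> z" and \<phi>_div: "\<phi> (x / z) = \<phi> x / \<phi> z"
    and \<phi>_pow: "\<phi> (x ^ j) = \<phi> x ^ j" and \<phi>_1: "\<phi> 1 = 1" and \<phi>_eq_0: "\<phi> x = 0 \<longleftrightarrow> x = 0" for x z j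
    unfolding \<phi>_def
    by (simp_all add: frob_add [OF char_3] frob_diff [OF char_3] power_mult_distrib power_divide
      power_mult [symmetric] mult.commute)
  have \<phi>3: "\<phi> (\<phi> (\<phi> y)) = y ^ 9"
  proof -
    have "\<phi> (\<phi> (\<phi> y)) = y ^ (3 ^ (3 * h))"
      by (simp add: \<phi>_def power_mult [symmetric] power_add [symmetric] mult_2 [symmetric])
    also have "\<dots> = y ^ 9"
      unfolding h by (simp add: power_add power_mult frob_m)
    finally show ?thesis .
  qed
  \<comment> \<open>This choice turns D = g^3 / (1 - g^2) into 1 / (k s).\<close>
  define k where "k = 1 / g"
  define s where "s = k ^ 2 - 1"
  define D where "D = \<phi> y - y"
  have k: "k \<noteq> 0" "g = 1 / k" using g(2) unfolding k_def by auto
  have yD: "D * (1 - g ^ 2) = g ^ 3" using y unfolding D_def \<phi>_def .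
  have s: "s \<noteq> 0"
  proof
    assume "s = 0"
    then have "1 - g ^ 2 = 0" unfolding s_def k(2) using k(1) by (simp add: field_simps)
    with yD g(2) show False by simp
  qed
  have D: "D = 1 / (k * s)"
  proof -
    have "D * (k * s) * g ^ 3 = (D * (1 - g ^ 2)) * 1"
      unfolding s_def k(2) using k(1) by (simp add: field_simps eval_nat_numeral)
    with yD g(2) have "D * (k * s) = 1" by simp
    then show ?thesis using k(1) s by (simp add: field_simps)
  qed
  \<comment> \<open>Cubing is additive, so \<open>y\<close> drops out and the image of
    \<open>g\<close> depends on \<open>g\<close> and \<open>D\<close> only.\<close>
  have "\<phi> g = \<phi> y ^ 3 - \<phi> y" unfolding g(1) by (simp add: \<phi>_diff \<phi>_pow)
  also have "\<phi> y = y + D" unfolding D_def by simp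
  also have "(y + D) ^ 3 - (y + D) = g + D ^ 3 - D"
    unfolding cube_add_char_3 [OF char_3] g(1) by simp
  finally have \<phi>g: "\<phi> g = g + D ^ 3 - D" .
  have sn: "s ^ 2 + 1 \<noteq> 0" using nonsquare [of s] by (simp add: eq_neg_iff_add_eq_0)
  have \<phi>k_step: "\<phi> k * (s ^ 2 + 1) ^ 2 = k ^ 3 * s ^ 3"
  proof -
    have "k ^ 2 = s + 1" unfolding s_def by simp
    have "\<phi> g * (k ^ 3 * s ^ 3) = k ^ 2 * s ^ 3 + 1 - k ^ 2 * s ^ 2"
      unfolding \<phi>g unfolding D k(2) using k(1) s by (simp add: field_simps eval_nat_numeral)
    also have "\<dots> = (s ^ 2 + 1) ^ 2 - 3 * s ^ 2"
      unfolding \<open>k ^ 2 = s + 1\<close> by (simp add: eval_nat_numeral algebra_simps)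
    also have "\<dots> = (s ^ 2 + 1) ^ 2" unfolding char_3 by simp
    finally have "\<phi> g * (k ^ 3 * s ^ 3) = (s ^ 2 + 1) ^ 2" .
    then have "\<phi> k * (s ^ 2 + 1) ^ 2 = (\<phi> k * \<phi> g) * (k ^ 3 * s ^ 3)"
      by (simp add: mult.assoc)
    also have "\<phi> k * \<phi> g = 1"
      unfolding \<phi>_mult [symmetric] k_def using g(2) by (simp add: \<phi>_1)
    finally show ?thesis by simp
  qed
  define k1 where "k1 = \<phi> k"
  define k2 where "k2 = \<phi> k1"
  define s1 where "s1 = \<phi> s"
  define s2 where "s2 = \<phi> s1"
  note kdefs = k1_def k2_def s1_def s2_def
  note \<phi>_simps = \<phi>_add \<phi>_diff \<phi>_mult \<phi>_div \<phi>_pow \<phi>_1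
  have "val3 elim3 s = 0"
  proof (rule elim3_root [OF char_3 s_def])
    show "s1 = k1 ^ 2 - 1" unfolding kdefs s_def by (simp add: \<phi>_simps)
    then show "s2 = k2 ^ 2 - 1" unfolding s2_def k2_def by (simp add: \<phi>_simps)
    show "k \<noteq> 0" "k1 \<noteq> 0" "k2 \<noteq> 0" "s \<noteq> 0" "s1 \<noteq> 0" "s2 \<noteq> 0"
      using k s unfolding kdefs by (simp_all add: \<phi>_eq_0)
    show "s ^ 2 + 1 \<noteq> 0" "s1 ^ 2 + 1 \<noteq> 0"
      using nonsquare by (simp_all add: eq_neg_iff_add_eq_0)
    show "k1 * (s ^ 2 + 1) ^ 2 = k ^ 3 * s ^ 3"
      unfolding k1_def by (rule \<phi>k_step)
    then have "\<phi> (k1 * (s ^ 2 + 1) ^ 2) = \<phi> (k ^ 3 * s ^ 3)" by simp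
    then show "k2 * (s1 ^ 2 + 1) ^ 2 = k1 ^ 3 * s1 ^ 3"
      unfolding k2_def s1_def by (simp add: \<phi>_simps k1_def)
    have "1 / (k * s) + 1 / (k1 * s1) + 1 / (k2 * s2) = D + \<phi> D + \<phi> (\<phi> D)"
      unfolding D kdefs by (simp add: \<phi>_simps)
    also have "\<dots> = y ^ 9 - y"
      unfolding D_def by (simp add: \<phi>_simps \<phi>3)
    also have "\<dots> = (y ^ 3 - y) ^ 3 + (y ^ 3 - y)"
      using cube_add_char_3 [OF char_3, of "y ^ 3 - y" y] by (simp add: power_mult [symmetric])
    also have "\<dots> = 1 / k ^ 3 + 1 / k"
      unfolding g(1) [symmetric] k(2) by (simp add: power_divide)
    finally show "1 / (k * s) + 1 / (k1 * s1) + 1 / (k2 * s2) = 1 / k ^ 3 + 1 / k" .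
  qed
  moreover have "val3 elim3 s \<noteq> 0"
    by (rule elim3_no_root [OF char_3 nonsquare _ k(1)]) (simp_all add: s_def)
  ultimately show False by blast
qed

section \<open>Finite fields of characteristic three\<close>

text \<open>Translation by 1 permutes the field, so the sum of all elements is unchanged when 1 is
  added to each.\<close>

lemma of_nat_card_field_eq_0:
  assumes "finite (UNIV :: 'a::field set)"
  shows "of_nat CARD('a) = (0 :: 'a)"
proof -
  have "(\<Sum>y\<in>(UNIV :: 'a set). y) = (\<Sum>y\<in>UNIV. y + 1)"
    by (rule sum.reindex_bij_witness [of _ "\<lambda>y. y + 1" "\<lambda>y. y - 1"]) auto
  then show ?thesis by (simp add: sum.distrib)
qed

lemma power_card_minus_1_eq_1:
  fixes x :: "'a::field"
  assumes fin: "finite (UNIV :: 'a set)" and x: "x \<noteq> 0"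
  shows "x ^ (CARD('a) - 1) = 1"
proof -
  have "(\<Prod>y\<in>UNIV - {0}. y) = (\<Prod>y\<in>UNIV - {0}. x * y)"
    by (rule prod.reindex_bij_witness [of _ "\<lambda>y. x * y" "\<lambda>y. y / x"]) (use x in auto)
  also have "\<dots> = x ^ card (UNIV - {0 :: 'a}) * (\<Prod>y\<in>UNIV - {0}. y)"
    by (simp add: prod.distrib)
  finally show ?thesis using fin by (simp add: prod_zero_iff card_Diff_singleton)
qed

lemma power_card_eq:
  fixes x :: "'a::field"
  assumes fin: "finite (UNIV :: 'a set)"
  shows "x ^ CARD('a) = x"
proof (cases "x = 0")
  case False
  have "CARD('a) = Suc (CARD('a) - 1)" using fin by (simp add: card_gt_0_iff)
  then have "x ^ CARD('a) = x * x ^ (CARD('a) - 1)" by (metis power_Suc)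
  then show ?thesis using power_card_minus_1_eq_1 [OF fin False] by simp
qed (use fin in \<open>simp add: zero_power card_gt_0_iff\<close>)

lemma card_power_3_char_3:
  assumes "CARD('a::field) = 3 ^ m"
  shows "(3 :: 'a) = 0"
proof -
  have "finite (UNIV :: 'a set)" using assms by (intro card_ge_0_finite) simp
  from of_nat_card_field_eq_0 [OF this] show ?thesis by (simp add: assms)
qed

lemma frob_inj:
  fixes x y :: "'a::field"
  assumes "(3 :: 'a) = 0" and "x ^ (3 ^ j) = y ^ (3 ^ j)"
  shows "x = y"
  using frob_diff [OF assms(1), of x y j] assms(2) by simp

text \<open>Such a \<open>z\<close> lies in the fields with 9 and with 3^m elements, which meet in
  the prime field for odd \<open>m\<close>: 3^m = 9^j * 3, so the 3^m-th power of \<open>z\<close>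
  is its cube.\<close>

lemma power_9_fixed:
  fixes z :: "'a::field"
  assumes frob_m: "\<And>x :: 'a. x ^ (3 ^ m) = x" and "odd m" and z: "z ^ 9 = z"
  shows "z ^ 3 = z"
proof -
  obtain j where m: "m = 2 * j + 1" using \<open>odd m\<close> by (elim oddE)
  have "z ^ (9 ^ j) = z"
    by (induction j) (simp_all add: power_mult z)
  moreover have "(3 :: nat) ^ m = 9 ^ j * 3"
    unfolding m by (simp add: power_mult)
  ultimately show ?thesis using frob_m [of z] by (simp add: power_mult)
qed

text \<open>A square root of -1 is fixed by the ninth power, hence by the cube, yet its cube is its
  negative.\<close>

lemma minus_1_nonsquare:
  fixes z :: "'a::field"
  assumes char_3: "(3 :: 'a) = 0"
    and frob_m: "\<And>x :: 'a. x ^ (3 ^ m) = x" and "odd m"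
  shows "z ^ 2 \<noteq> - 1"
proof
  assume z: "z ^ 2 = - 1"
  have "z ^ 9 = (z ^ 2) ^ 4 * z" by Groebner_Basis.algebra
  then have "z ^ 9 = z" unfolding z by simp
  then have "z ^ 3 = z" by (rule power_9_fixed [OF frob_m \<open>odd m\<close>])
  moreover have "z ^ 3 = z ^ 2 * z" by Groebner_Basis.algebra
  ultimately have "2 * z = 0" unfolding z by (simp add: algebra_simps)
  moreover have "3 * z = 0" using char_3 by simp
  ultimately have "3 * z - 2 * z = 0" by (simp only: diff_self)
  then have "z = 0" by (simp add: algebra_simps)
  then show False using z by simp
qed

text \<open>In characteristic three \<open>a + b + c = 0\<close> means that \<open>a, b, c\<close> is an arithmetic progression
  \<open>d y, d (y + 1), d (y - 1)\<close>.\<close>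

lemma power_sum_imp_eq:
  fixes a b c :: "'a::field"
  assumes char_3: "(3 :: 'a) = 0"
    and frob_m: "\<And>x :: 'a. x ^ (3 ^ m) = x" and "odd m" and h: "3 * h = m + 2"
    and e: "2 * e = 3 ^ h + 5"
    and sum: "a + b + c = 0" and nz: "a \<noteq> 0" "b \<noteq> 0" "c \<noteq> 0"
    and psum: "a ^ e + b ^ e = c ^ e \<or> a ^ e + b ^ e = - (c ^ e)"
  shows "a = b"
proof (rule ccontr)
  assume "a \<noteq> b"
  define d where "d = b - a"
  have d: "d \<noteq> 0" using \<open>a \<noteq> b\<close> unfolding d_def by simp
  define y where "y = a / d"
  define Q where "Q = y ^ (3 ^ h)"
  define g where "g = y ^ 3 - y"
  have a: "a = d * y" unfolding y_def using d by simp
  have b: "b = d * (y + 1)" using a unfolding d_def by (simp add: algebra_simps)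
  have "c = d * (y - 1) - 3 * (d * y)"
    using sum unfolding a b by Groebner_Basis.algebra
  then have c: "c = d * (y - 1)" using char_3 by simp
  \<comment> \<open>Only \<open>2 * e\<close>, not \<open>e\<close> itself, is expressed through
    \<open>h\<close>; hence squares of e-th powers are computed.\<close>
  have pow: "(d * x) ^ e * (d * x) ^ e = d ^ (2 * e) * (x ^ (3 ^ h) * x ^ 5)" for x
  proof -
    have "(d * x) ^ e * (d * x) ^ e = (d * x) ^ (2 * e)"
      by (simp only: mult_2 power_add)
    also have "\<dots> = d ^ (2 * e) * x ^ (2 * e)" by (rule power_mult_distrib)
    also have "x ^ (2 * e) = x ^ (3 ^ h) * x ^ 5" unfolding e by (rule power_add)
    finally show ?thesis .
  qed
  have "Q + 1 = (y + 1) ^ (3 ^ h)" "Q - 1 = (y - 1) ^ (3 ^ h)"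
    unfolding Q_def by (simp_all add: frob_add [OF char_3] frob_diff [OF char_3])
  define X where "X = Q * y ^ 5"
  define Y where "Y = (Q + 1) * (y + 1) ^ 5"
  define Z where "Z = (Q - 1) * (y - 1) ^ 5"
  have sq: "a ^ e * a ^ e = d ^ (2 * e) * X" "b ^ e * b ^ e = d ^ (2 * e) * Y"
    "c ^ e * c ^ e = d ^ (2 * e) * Z"
    unfolding a b c pow X_def Y_def Z_def \<open>Q + 1 = _\<close> \<open>Q - 1 = _\<close>
    unfolding Q_def by simp_all
  \<comment> \<open>In characteristic three the form equals X^2 + Y^2 + Z^2 - 2XY - 2YZ - 2ZX. At
    squares A^2, B^2, C^2 it is, up to sign, the product of A + B + C, A + B - C, A - B + C and -A +
    B + C.\<close>
  have norm: "(A * A) ^ 2 + (B * B) ^ 2 + (C * C) ^ 2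
        + A * A * (B * B) + B * B * (C * C) + C * C * (A * A)
      = 3 * (A ^ 2 + A * B + B ^ 2) ^ 2"
    if "A + B = C \<or> A + B = - C" for A B C :: 'a
  proof -
    from that have C: "C * C = (A + B) ^ 2" by (auto simp: power2_eq_square)
    show ?thesis unfolding C by Groebner_Basis.algebra
  qed
  define w where "w = d ^ (2 * e)"
  have "w ^ 2 * (X ^ 2 + Y ^ 2 + Z ^ 2 + X * Y + Y * Z + Z * X) = (w * X) ^ 2 + (w * Y) ^ 2
      + (w * Z) ^ 2 + w * X * (w * Y) + w * Y * (w * Z) + w * Z * (w * X)"
    by Groebner_Basis.algebra
  also have "\<dots> = 0"
    using norm [OF psum] char_3 unfolding sq w_def [symmetric] by simp
  finally have "X ^ 2 + Y ^ 2 + Z ^ 2 + X * Y + Y * Z + Z * X = 0"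
    using d unfolding w_def by simp
  then have "(Q - y) * ((Q - y) * (1 - g ^ 2) - g ^ 3) = 0"
    unfolding norm_form_eq [OF char_3 g_def X_def Y_def Z_def] .
  then consider "Q = y" | "(Q - y) * (1 - g ^ 2) = g ^ 3" by auto
  then have "g = 0"
  proof cases
    \<comment> \<open>A fixed point of the q-th power map is fixed by its third iterate, the ninth
      power, hence lies in the prime field.\<close>
    case 1
    then have "y ^ (3 ^ h) = y" unfolding Q_def .
    then have "y ^ (3 ^ (h + h + h)) = y"
      by (simp add: power_add power_mult)
    moreover have "h + h + h = m + 2" using h by simp
    ultimately have "y ^ 9 = y" by (simp add: power_add power_mult frob_m)
    then show ?thesis unfolding g_def by (simp add: power_9_fixed [OF frob_m \<open>odd m\<close>])
  next
    case 2
    then show ?thesis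
      using no_frob_point [OF char_3 minus_1_nonsquare [OF char_3 frob_m \<open>odd m\<close>] frob_m h g_def]
      unfolding Q_def by blast
  qed
  \<comment> \<open>Up to the factor d^3 this is the nonzero product a b c.\<close>
  moreover have "g = y * (y + 1) * (y - 1)" unfolding g_def by Groebner_Basis.algebra
  ultimately show False using nz unfolding a b c by auto
qed

section \<open>Arithmetic of the exponent \<open>e\<close>\<close>

lemma prime_factor_67_free:
  assumes "odd m"
  shows "\<not> (67 :: nat) dvd 3 ^ m - 1"
proof
  assume "67 dvd (3 :: nat) ^ m - 1"
  then have "[3 ^ m = 1] (mod (67::nat))"
    by (subst cong_altdef_nat) simp_all
  then have "[(3 ^ m) ^ 11 = 1 ^ 11] (mod (67::nat))" by (rule cong_pow)
  \<comment> \<open>The residue 66 is -1: since 3^11 = -1 modulo 67, an odd power of it is -1 and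
    not 1.\<close>
  moreover have "[(3 ^ 11) ^ m = 66 ^ m] (mod (67::nat))"
    by (intro cong_pow) (simp add: cong_def)
  moreover have "[66 ^ m = 66] (mod (67::nat))"
  proof -
    obtain j where m: "m = 2 * j + 1" using assms by (elim oddE)
    have "[(66 ^ 2) ^ j = 1 ^ j] (mod (67::nat))"
      by (intro cong_pow) (simp add: cong_def)
    then have "[(66 ^ 2) ^ j * 66 = 1 ^ j * 66] (mod (67::nat))" by (rule cong_mult) simp
    then show ?thesis unfolding m power_add power_mult power_one mult_1 power_one_right .
  qed
  ultimately have "[66 = 1] (mod (67::nat))"
    by (metis cong_trans cong_sym power_mult mult.commute power_one)
  then show False by (simp add: cong_def)
qed

text \<open>With \<open>A = 3\<^sup>h\<close>, the factor \<open>2 e = A + 5\<close> divides \<open>A\<^sup>3 + 125 = 9 n + 134\<close>, so the gcd of \<open>2 e\<close> and \<open>n\<close>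
  divides \<open>134 = 2 * 67\<close>.\<close>

lemma exponent_not_in_subfield:
  fixes e h m t :: nat
  assumes "odd m" and h: "3 * h = m + 2" and e: "2 * e = 3 ^ h + 5" and t: "0 < t" "t < m"
  shows "\<not> 3 ^ m - 1 dvd e * (3 ^ t - 1)"
proof
  define n :: nat where "n = 3 ^ m - 1"
  assume "3 ^ m - 1 dvd e * (3 ^ t - 1)"
  then have "int n dvd int (e * (3 ^ t - 1))" unfolding n_def by (rule int_dvd_int_iff [THEN iffD2])
  define A :: int where "A = 3 ^ h"
  have "2 * int e = A + 5" using arg_cong [OF e, of int] unfolding A_def by simp
  then have "2 * int e * (A ^ 2 - 5 * A + 25) = A ^ 3 + 125"
    by Groebner_Basis.algebra
  also have "A ^ 3 = 9 * int (n + 1)"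
  proof -
    have "A ^ 3 = 3 ^ (m + 2)" unfolding A_def h [symmetric] by (simp add: power_mult mult.commute)
    then show ?thesis unfolding n_def by (simp add: power_add)
  qed
  finally have W: "2 * int e * (A ^ 2 - 5 * A + 25) = 9 * int n + 134" by simp
  have "int n dvd int (e * (3 ^ t - 1)) * (2 * (A ^ 2 - 5 * A + 25))"
    using \<open>int n dvd _\<close> by (rule dvd_mult2)
  also have "\<dots> = (2 * int e * (A ^ 2 - 5 * A + 25)) * int (3 ^ t - 1)"
    by (simp add: algebra_simps)
  also have "\<dots> = int n * (9 * int (3 ^ t - 1)) + int (67 * (2 * (3 ^ t - 1)))"
    unfolding W by (simp add: algebra_simps)
  finally have "int n dvd int (67 * (2 * (3 ^ t - 1)))"
    by (simp add: dvd_add_right_iff)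
  then have "n dvd 67 * (2 * (3 ^ t - 1))" unfolding int_dvd_int_iff .
  \<comment> \<open>The prime 67 cancels. The factor 2 stays because \<open>n\<close> is even, and
    the bound n + 1 >= 3 * 3^t absorbs it.\<close>
  moreover have "coprime n 67"
    unfolding n_def coprime_commute [of _ 67]
    by (rule prime_imp_coprime [OF _ prime_factor_67_free [OF \<open>odd m\<close>]]) simp
  ultimately have "n dvd 2 * (3 ^ t - 1)" by (metis coprime_dvd_mult_right_iff)
  moreover have one: "1 < (3 :: nat) ^ t" using t(1) by (intro one_less_power) auto
  ultimately have "n \<le> 2 * (3 ^ t - 1)" by (intro dvd_imp_le) auto
  moreover have "(3 :: nat) ^ Suc t \<le> 3 ^ m" using t(2) by (intro power_increasing) auto
  ultimately show False unfolding n_def power_Suc using one by linarith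
qed

section \<open>Linear codes over finite fields\<close>

text \<open>Coordinates in a finite basis biject the space with functions from the basis to the
  field. This allows dimensions of codes to be found by counting words.\<close>

lemma (in vectorspace) card_carrier_eq_power_dim:
  assumes "finite (carrier V)"
  shows "card (carrier V) = card (carrier K) ^ dim"
proof -
  have "span (carrier V) = carrier V"
    using in_own_span [of "carrier V"] span_is_subset2 [of "carrier V"] by blast
  then have "fin_dim" unfolding fin_dim_def using assms by blast
  then obtain B where B: "finite B" "basis B" using finite_basis_exists by blast
  then have "B \<subseteq> carrier V" unfolding basis_def by blast
  have *: "\<exists>!a. a \<in> B \<rightarrow>\<^sub>E carrier K \<and> lincomb a B = v" if "v \<in> carrier V" for v
    using basis_criterion [OF B(1) \<open>B \<subseteq> carrier V\<close>] B(2) that by blast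
  have closed: "lincomb a B \<in> carrier V" if "a \<in> B \<rightarrow>\<^sub>E carrier K" for a
    using that \<open>B \<subseteq> carrier V\<close> by (intro lincomb_closed) auto
  have "bij_betw (\<lambda>a. lincomb a B) (B \<rightarrow>\<^sub>E carrier K) (carrier V)"
    unfolding bij_betw_def inj_on_def using * closed by blast
  then have "card (carrier V) = card (B \<rightarrow>\<^sub>E carrier K)" by (simp add: bij_betw_same_card)
  also have "\<dots> = card (carrier K) ^ card B" using B(1) by (simp add: card_funcsetE)
  finally show ?thesis using dim_basis [OF B] by simp
qed

lemma card_carrier_vec_field:
  "card (carrier_vec n :: 'k vec set) = CARD('k) ^ n"
  if "finite (UNIV :: 'k set)"
proof -
  have "bij_betw vec_of_list {xs :: 'k list. length xs = n} (carrier_vec n)"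
    by (rule bij_betw_byWitness [of _ list_of_vec]) (auto simp: vec_list list_vec intro: carrier_vecI)
  then have "card (carrier_vec n :: 'k vec set) = card {xs :: 'k list. length xs = n}"
    by (simp add: bij_betw_same_card)
  then show ?thesis using card_lists_length_eq [OF that, of n] by simp
qed

lemma finite_carrier_vec_field:
  assumes "finite (UNIV :: 'k set)"
  shows "finite (carrier_vec n :: 'k vec set)"
proof -
  have "CARD('k) > 0" using assms by (simp add: card_gt_0_iff)
  then show ?thesis using card_carrier_vec_field [OF assms, of n] by (intro card_ge_0_finite) simp
qed

lemma card_subspace_vec:
  fixes C :: "'k::field vec set"
  assumes "finite (UNIV :: 'k set)" and C: "VectorSpace.subspace class_ring C (module_vec TYPE('k) n)"
  shows "card C = CARD('k) ^ vectorspace.dim class_ring ((module_vec TYPE('k) n)\<lparr>carrier := C\<rparr>)"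
proof -
  interpret V: vectorspace class_ring "module_vec TYPE('k) n" by (rule vec_vs)
  interpret W: vectorspace class_ring "(module_vec TYPE('k) n)\<lparr>carrier := C\<rparr>"
    by (rule V.subspace_is_vs [OF C])
  have "C \<subseteq> carrier_vec n"
    using submodule.subset [OF V.is_module [OF C]] by (simp add: module_vec_simps)
  then have "finite C" using finite_carrier_vec_field [OF assms(1)] by (rule finite_subset)
  then show ?thesis using W.card_carrier_eq_power_dim by simp
qed

text \<open>The larger position \<open>j\<close> comes first so that \<open>SIGMA j. {..<j}\<close>
  runs over each two-element support once.\<close>

definition err_vec :: "nat \<Rightarrow> (nat \<times> nat) \<times> 'k \<times> 'k \<Rightarrow> 'k::zero vec" where
  "err_vec n = (\<lambda>((j, i), a, b). vec n (\<lambda>l. if l = i then a else if l = j then b else 0))"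

text \<open>Sphere packing with the error patterns of weight exactly two: there are
  $4 \binom{n}{2} > (n+1)^2 = 3^{2m}$ of them.\<close>

lemma sphere_packing:
  fixes C :: "'k::field vec set"
  assumes card_k: "CARD('k) = 3" and n: "n = 3 ^ m - 1" "n \<ge> 5"
    and C: "C \<subseteq> carrier_vec n" "card C = 3 ^ (n - 2 * m)" and m: "2 * m \<le> n"
  shows "\<exists>u\<in>C. \<exists>v\<in>C. u \<noteq> v \<and> hamming_dist u v < 5"
proof (rule ccontr)
  assume "\<not> ?thesis"
  then have dist: "u = v" if "u \<in> C" "v \<in> C" "hamming_dist u v < 5" for u v
    using that by blast
  have fin: "finite (UNIV :: 'k set)" using card_k by (intro card_ge_0_finite) simp
  define E :: "((nat \<times> nat) \<times> 'k \<times> 'k) set"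
    where "E = (SIGMA j:{..<n}. {..<j}) \<times> (UNIV - {0}) \<times> (UNIV - {0})"
  have supp: "err_vec n ((j, i), a, b) $ l = (if l = i then a else if l = j then b else 0)"
    if "l < n" for i j l and a b :: 'k
    using that unfolding err_vec_def by simp
  have err_carrier: "err_vec n t \<in> carrier_vec n" for t :: "(nat \<times> nat) \<times> 'k \<times> 'k"
    unfolding err_vec_def by (auto split: prod.split)
  note err_dim = carrier_vecD [OF err_carrier]
  have err_inj: "t = t'" if "t \<in> E" "t' \<in> E" "err_vec n t = err_vec n t'" for t t'
  proof -
    obtain j i a b where t: "t = ((j, i), a, b)" by (metis prod.exhaust)
    obtain j' i' a' b' where t': "t' = ((j', i'), a', b')" by (metis prod.exhaust)
    have *: "i < j" "j < n" "a \<noteq> 0" "b \<noteq> 0" "i' < j'" "j' < n" "a' \<noteq> 0" "b' \<noteq> 0"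
      using that(1,2) unfolding E_def t t' by auto
    have eq: "(if l = i then a else if l = j then b else 0) = (if l = i' then a' else if l = j' then b' else 0)"
      if "l < n" for l
      using arg_cong [OF \<open>err_vec n t = err_vec n t'\<close>, of "\<lambda>v. v $ l"]
      unfolding t t' supp [OF that] .
    have iff: "l = i \<or> l = j \<longleftrightarrow> l = i' \<or> l = j'" if "l < n" for l
      using eq [OF that] * by (auto split: if_splits)
    have "i < n" "i' < n" using * by simp_all
    then have "i = i' \<or> i = j'" "j = i' \<or> j = j'" "i' = i \<or> i' = j"
      using iff [of i] iff [of j] iff [of i'] *(2) by blast+
    then have "i = i'" "j = j'" using *(1,5) by auto
    then show ?thesis
      using eq [of i] eq [of j] * unfolding t t' by auto
  qed
  have inj: "inj_on (\<lambda>(c, t). c + err_vec n t) (C \<times> E)"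
  proof (rule inj_onI, clarify)
    fix c c' :: "'k vec" and j i j' i' :: nat and a b a' b' :: 'k
    let ?t = "((j, i), a, b)" and ?t' = "((j', i'), a', b')"
    assume c: "c \<in> C" "c' \<in> C" and t: "?t \<in> E" "?t' \<in> E"
      and eq: "c + err_vec n ?t = c' + err_vec n ?t'"
    have c_n: "c \<in> carrier_vec n" "c' \<in> carrier_vec n" using c C(1) by auto
    have pt: "c $ l + err_vec n ?t $ l = c' $ l + err_vec n ?t' $ l" if "l < n" for l
      using arg_cong [OF eq, of "\<lambda>v. v $ l"] that by (simp add: err_dim)
    \<comment> \<open>Two error patterns touch at most four positions, fewer than the assumed
      distance 5.\<close>
    have "{l. l < dim_vec c \<and> c $ l \<noteq> c' $ l} \<subseteq> {i, j, i', j'}"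
    proof (rule subsetI, rule ccontr)
      fix l assume l: "l \<in> {l. l < dim_vec c \<and> c $ l \<noteq> c' $ l}" "l \<notin> {i, j, i', j'}"
      then show False using pt [of l] supp [of l] c_n(1) by simp
    qed
    then have "hamming_dist c c' \<le> card {i, j, i', j'}"
      unfolding hamming_dist_def by (intro card_mono) auto
    also have "\<dots> \<le> 4" using card_length [of "[i, j, i', j']"] by simp
    finally have cc: "c = c'" by (intro dist c) simp
    have "err_vec n ?t = err_vec n ?t'"
      using pt unfolding cc by (intro eq_vecI) (simp_all add: err_dim)
    from err_inj [OF t this] cc
    show "c = c' \<and> ?t = ?t'" by simp
  qed
  have "card (SIGMA j:{..<n}. {..<j}) * 2 = n * (n - 1)"
  proof -
    have "card (SIGMA j:{..<n}. {..<j}) = (\<Sum>j<n. j)" by (simp add: card_SigmaI)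
    also have "\<dots> * 2 = n * (n - 1)" by (induction n) (auto simp: algebra_simps)
    finally show ?thesis .
  qed
  moreover have "card (UNIV - {0 :: 'k}) = 2" using card_k fin by (simp add: card_Diff_singleton)
  ultimately have card_E: "card E = 2 * (n * (n - 1))"
    unfolding E_def card_cartesian_product by simp
  have "(\<lambda>(c, t). c + err_vec n t) ` (C \<times> E) \<subseteq> carrier_vec n"
    using C(1) err_carrier by auto
  then have "card (C \<times> E) \<le> card (carrier_vec n :: 'k vec set)"
    by (intro card_inj_on_le [OF inj] finite_carrier_vec_field [OF fin])
  then have "3 ^ (n - 2 * m) * (2 * (n * (n - 1))) \<le> (3 :: nat) ^ n"
    by (simp add: card_cartesian_product card_E C(2) card_carrier_vec_field [OF fin] card_k)
  also have "(3 :: nat) ^ n = 3 ^ (n - 2 * m) * (3 ^ m) ^ 2"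
    using m by (simp add: power_mult [symmetric] power_add [symmetric] mult.commute)
  also have "(3 :: nat) ^ m = n + 1" unfolding n(1) by simp
  finally have "2 * (n * (n - 1)) \<le> (n + 1) ^ 2" by simp
  \<comment> \<open>The difference of the two sides is n^2 - 4n - 1, positive from n = 5 on.\<close>
  moreover obtain q where "n = q + 5" using n(2) by (metis le_iff_add add.commute)
  ultimately show False by (simp add: power2_eq_square algebra_simps)
qed

section \<open>Cyclic codes\<close>

lemma coeff_vec_poly: "coeff (vec_poly c) i = (if i < dim_vec c then c $ i else 0)"
  unfolding vec_poly_def by (simp add: coeff_sum coeff_monom sum.delta)

lemma vec_poly_add: "dim_vec u = dim_vec v \<Longrightarrow> vec_poly (u + v) = vec_poly u + vec_poly v"
  by (rule poly_eqI) (auto simp: coeff_vec_poly)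

lemma vec_poly_smult: "vec_poly (a \<cdot>\<^sub>v u) = Polynomial.smult a (vec_poly u)"
  by (rule poly_eqI) (auto simp: coeff_vec_poly)

lemma vec_poly_zero: "vec_poly (0\<^sub>v n) = 0"
  by (rule poly_eqI) (auto simp: coeff_vec_poly)

lemma bij_betw_vec_poly: "bij_betw vec_poly (carrier_vec n) {p :: 'k::field poly. \<forall>i\<ge>n. coeff p i = 0}"
proof (rule bij_betw_byWitness [of _ "\<lambda>p. vec n (coeff p)"])
  show "\<forall>c\<in>carrier_vec n. vec n (coeff (vec_poly c)) = c"
    by (auto simp: coeff_vec_poly)
  show "\<forall>p\<in>{p :: 'k poly. \<forall>i\<ge>n. coeff p i = 0}. vec_poly (vec n (coeff p)) = p"
    by (auto simp: coeff_vec_poly poly_eq_iff)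
qed (auto simp: coeff_vec_poly)

lemma coeff_bounded_iff_degree:
  "(\<forall>i\<ge>n. coeff p i = 0) \<longleftrightarrow> p = 0 \<or> degree p < n"
  by (metis coeff_0 coeff_eq_0 leD leI le_trans less_le_trans leading_coeff_0_iff)

text \<open>As \<open>g\<close> divides x^n - 1, the congruence may be reduced modulo
  \<open>g\<close>; ideal membership becomes plain divisibility.\<close>

lemma mem_principal_cyclic_code_iff:
  fixes g :: "'k::field poly"
  assumes "g dvd monom 1 n - 1"
  shows "c \<in> principal_cyclic_code n g \<longleftrightarrow> c \<in> carrier_vec n \<and> g dvd vec_poly c"
proof -
  have "(\<exists>a. [vec_poly c = a * g] (mod monom 1 n - 1)) \<longleftrightarrow> g dvd vec_poly c"
  proof
    assume "\<exists>a. [vec_poly c = a * g] (mod monom 1 n - 1)"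
    then obtain a where "[vec_poly c = a * g] (mod monom 1 n - 1)" ..
    then have "[vec_poly c = a * g] (mod g)" using assms by (rule cong_dvd_modulus)
    then show "g dvd vec_poly c" by (simp add: cong_def mod_eq_0_iff_dvd)
  next
    assume "g dvd vec_poly c"
    then obtain a where "vec_poly c = a * g" by (metis dvd_def mult.commute)
    then have "[vec_poly c = a * g] (mod monom 1 n - 1)" by simp
    then show "\<exists>a. [vec_poly c = a * g] (mod monom 1 n - 1)" ..
  qed
  then show ?thesis unfolding principal_cyclic_code_def by auto
qed

lemma degree_monom_minus_1: "n > 0 \<Longrightarrow> degree (monom 1 n - 1 :: 'k::field poly) = n"
proof -
  assume n: "n > 0"
  have "degree (monom 1 n + (- 1) :: 'k poly) = degree (monom 1 n :: 'k poly)"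
    using n by (intro degree_add_eq_left) (simp add: degree_monom_eq)
  then show ?thesis by (simp add: degree_monom_eq)
qed

text \<open>A monic generator \<open>h\<close> of smaller degree would have degree below
  \<open>n\<close>, hence be a word of the code itself and divisible by \<open>g\<close>.\<close>

lemma cyclic_code_eq_principal:
  fixes g :: "'k::field poly"
  assumes g: "lead_coeff g = 1" "g dvd monom 1 n - 1" and n: "n > 0"
  shows "cyclic_code n g = principal_cyclic_code n g"
proof -
  have "degree g \<le> n"
    using dvd_imp_degree_le [OF g(2)] degree_monom_minus_1 [OF n, where 'k = 'k] n
    by (metis degree_0 less_numeral_extra(3))
  have "degree g \<le> degree h"
    if h: "lead_coeff h = 1" "principal_cyclic_code n g = principal_cyclic_code n h" for h
  proof (rule ccontr)
    assume less: "\<not> degree g \<le> degree h"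
    then have "degree h < n" using \<open>degree g \<le> n\<close> by simp
    then have "h \<in> vec_poly ` carrier_vec n"
      unfolding bij_betw_imp_surj_on [OF bij_betw_vec_poly] mem_Collect_eq coeff_bounded_iff_degree ..
    then obtain c where c: "c \<in> carrier_vec n" "vec_poly c = h" by blast
    have "[vec_poly c = 1 * h] (mod monom 1 n - 1)" unfolding c(2) by simp
    then have "c \<in> principal_cyclic_code n h"
      unfolding principal_cyclic_code_def using c(1) by blast
    then have "g dvd h"
      unfolding h(2) [symmetric] mem_principal_cyclic_code_iff [OF g(2)] c(2) by simp
    moreover have "h \<noteq> 0" using h(1) by auto
    ultimately show False using less dvd_imp_degree_le by blast
  qed
  then have "is_generator_poly n (principal_cyclic_code n g) g"
    unfolding is_generator_poly_def using g(1) by auto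
  then show ?thesis
    unfolding cyclic_code_def by (rule the_equality) (simp add: is_generator_poly_def)
qed

lemma subspace_principal_cyclic_code:
  fixes g :: "'k::field poly"
  assumes "g dvd monom 1 n - 1"
  shows "VectorSpace.subspace class_ring (principal_cyclic_code n g) (module_vec TYPE('k) n)"
  unfolding VectorSpace.subspace_def submodule_def
  by (auto simp: vec_vs vec_module module_vec_simps mem_principal_cyclic_code_iff [OF assms]
    vec_poly_add vec_poly_smult vec_poly_zero dvd_smult)

text \<open>The words are exactly the products a * g with \<open>a\<close> zero or of degree below n
  - deg g.\<close>

lemma card_principal_cyclic_code:
  fixes g :: "'k::field poly"
  assumes fin: "finite (UNIV :: 'k set)" and g: "lead_coeff g = 1" "g dvd monom 1 n - 1" "degree g \<le> n"
  shows "card (principal_cyclic_code n g) = CARD('k) ^ (n - degree g)"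
proof -
  define B :: "nat \<Rightarrow> 'k poly set" where "B r = {p. \<forall>i\<ge>r. coeff p i = 0}" for r
  have B: "p \<in> B r \<longleftrightarrow> p = 0 \<or> degree p < r" for p r
    unfolding B_def mem_Collect_eq coeff_bounded_iff_degree ..
  have "g \<noteq> 0" using g(1) by auto
  have "principal_cyclic_code n g = {c \<in> carrier_vec n. g dvd vec_poly c}"
    using mem_principal_cyclic_code_iff [OF g(2)] by blast
  then have "vec_poly ` principal_cyclic_code n g = {p \<in> vec_poly ` carrier_vec n. g dvd p}"
    by blast
  also have "vec_poly ` carrier_vec n = B n"
    unfolding B_def by (rule bij_betw_imp_surj_on [OF bij_betw_vec_poly])
  also have "{p \<in> B n. g dvd p} = (\<lambda>a. a * g) ` B (n - degree g)"
  proof (intro equalityI subsetI)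
    fix p assume "p \<in> {p \<in> B n. g dvd p}"
    then obtain a where a: "p = a * g" "a * g \<in> B n" by (metis dvd_def mem_Collect_eq mult.commute)
    then have "a \<in> B (n - degree g)"
      using \<open>g \<noteq> 0\<close> unfolding B by (cases "a = 0") (auto simp: degree_mult_eq)
    then show "p \<in> (\<lambda>a. a * g) ` B (n - degree g)" using a(1) by blast
  next
    fix p assume "p \<in> (\<lambda>a. a * g) ` B (n - degree g)"
    then obtain a where "p = a * g" "a = 0 \<or> degree a < n - degree g"
      unfolding image_iff Bex_def B by blast
    then show "p \<in> {p \<in> B n. g dvd p}"
      using \<open>g \<noteq> 0\<close> unfolding B by (cases "a = 0") (auto simp: degree_mult_eq)
  qed
  finally have "vec_poly ` principal_cyclic_code n g = (\<lambda>a. a * g) ` B (n - degree g)" .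
  moreover have "inj_on vec_poly (principal_cyclic_code n g)"
    using bij_betw_imp_inj_on [OF bij_betw_vec_poly [of n, where 'k = 'k]]
    by (rule inj_on_subset) (auto simp: principal_cyclic_code_def)
  moreover have "inj_on (\<lambda>a. a * g) (B (n - degree g))"
    using \<open>g \<noteq> 0\<close> by (auto intro: inj_onI)
  ultimately have "card (principal_cyclic_code n g) = card (B (n - degree g))"
    by (metis card_image)
  also have "\<dots> = card (carrier_vec (n - degree g) :: 'k vec set)"
    unfolding B_def by (rule bij_betw_same_card [OF bij_betw_vec_poly, symmetric])
  finally show ?thesis by (simp add: card_carrier_vec_field [OF fin])
qed

section \<open>Minimal polynomials\<close>

locale ternary_extension = field_hom \<iota> for \<iota> :: "'k::field \<Rightarrow> 'f::field" +
  fixes m :: nat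
  assumes card_k: "CARD('k) = 3" and card_f: "CARD('f) = 3 ^ m"
begin

interpretation poly_hom: map_poly_comm_ring_hom \<iota> by unfold_locales

lemma fin_k: "finite (UNIV :: 'k set)"
  using card_k by (intro card_ge_0_finite) simp

lemma fin_f: "finite (UNIV :: 'f set)"
  using card_f by (intro card_ge_0_finite) simp

lemma char_3: "(3 :: 'f) = 0"
  by (rule card_power_3_char_3 [OF card_f])

lemma frob_m: "x ^ (3 ^ m) = x" for x :: 'f
  using power_card_eq [OF fin_f, of x] by (simp add: card_f)

lemma frob_k: "a ^ 3 = a" for a :: 'k
  using power_card_eq [OF fin_k, of a] by (simp add: card_k)

lemma hom_k_cases: "\<iota> a = 1 \<or> \<iota> a = - 1" if "a \<noteq> 0"
proof -
  have "a * (a ^ 2 - 1) = 0"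
    using frob_k [of a] by (simp add: algebra_simps power2_eq_square power3_eq_cube)
  with that have "a ^ 2 = 1" by simp
  then have "a = 1 \<or> a = - 1" by (simp add: power2_eq_1_iff)
  then show ?thesis by (auto simp: hom_distribs)
qed

definition ev :: "'f \<Rightarrow> 'k poly \<Rightarrow> 'f" where
  "ev x p = poly (map_poly \<iota> p) x"

lemma ev_hom:
  "ev x (p + q) = ev x p + ev x q" "ev x (p - q) = ev x p - ev x q" "ev x (p * q) = ev x p * ev x q"
  "ev x 0 = 0" "ev x (Polynomial.smult a p) = \<iota> a * ev x p" "ev x (monom a i) = \<iota> a * x ^ i" "ev x 1 = 1"
  "ev x (pCons a p) = \<iota> a + x * ev x p"
  unfolding ev_def by (simp_all add: hom_distribs poly_monom)

lemma ev_vec_poly: "ev x (vec_poly c) = (\<Sum>i<dim_vec c. \<iota> (c $ i) * x ^ i)"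
proof -
  have "ev x (\<Sum>i<r. monom (f i) i) = (\<Sum>i<r. \<iota> (f i) * x ^ i)" for f r
    by (induction r) (simp_all add: ev_hom)
  then show ?thesis unfolding vec_poly_def .
qed

text \<open>Cubing fixes the coefficients, so it commutes with evaluation; conjugates of a root are
  roots.\<close>

lemma ev_frob: "ev (x ^ (3 ^ j)) p = ev x p ^ (3 ^ j)"
proof -
  have *: "ev (x ^ 3) p = ev x p ^ 3" for x
  proof (induction p)
    case (pCons a p)
    have "\<iota> a ^ 3 = \<iota> a" using frob_k [of a] by (simp add: hom_distribs [symmetric])
    then show ?case
      by (simp add: ev_hom pCons.IH cube_add_char_3 [OF char_3] power_mult_distrib)
  qed (simp add: ev_hom)
  show ?thesis
  proof (induction j)
    case (Suc j)
    have "ev (x ^ (3 ^ Suc j)) p = ev ((x ^ (3 ^ j)) ^ 3) p"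
      by (simp add: power_mult [symmetric] mult.commute)
    then show ?case unfolding * Suc.IH by (simp add: power_mult [symmetric] mult.commute)
  qed simp
qed

lemma card_ev_roots_le:
  assumes "p \<noteq> 0" and "\<And>x. x \<in> S \<Longrightarrow> ev x p = 0"
  shows "card S \<le> degree p"
proof -
  have nz: "map_poly \<iota> p \<noteq> 0" using assms(1) by simp
  have "card S \<le> card {x. poly (map_poly \<iota> p) x = 0}"
    using assms(2) poly_roots_finite [OF nz] unfolding ev_def by (intro card_mono) auto
  also have "\<dots> \<le> degree (map_poly \<iota> p)" by (rule card_poly_roots_bound [OF nz])
  finally show ?thesis by simp
qed

lemma monic_multiple_root:
  assumes "p \<noteq> 0" "ev x p = 0"
  shows "\<exists>q. lead_coeff q = 1 \<and> ev x q = 0 \<and> degree q = degree p"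
  using assms by (intro exI [of _ "Polynomial.smult (inverse (lead_coeff p)) p"]) (simp add: ev_hom)

text \<open>Pigeonhole: 3^(m+1) coefficient vectors have only 3^m possible values at
  \<open>x\<close>.\<close>

lemma ex_annihilator: "\<exists>p. p \<noteq> 0 \<and> ev x p = 0 \<and> degree p \<le> m"
proof -
  have "\<not> inj_on (\<lambda>c. ev x (vec_poly c)) (carrier_vec (Suc m))"
  proof
    assume "inj_on (\<lambda>c. ev x (vec_poly c)) (carrier_vec (Suc m))"
    then have "card (carrier_vec (Suc m) :: 'k vec set) \<le> CARD('f)"
      using fin_f by (intro card_inj_on_le) auto
    then show False unfolding card_carrier_vec_field [OF fin_k] card_k card_f by simp
  qed
  then obtain u v where uv: "u \<in> carrier_vec (Suc m)" "v \<in> carrier_vec (Suc m)" "u \<noteq> v"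
    "ev x (vec_poly u) = ev x (vec_poly v)" unfolding inj_on_def by blast
  define p where "p = vec_poly u - vec_poly v"
  have "vec_poly u \<noteq> vec_poly v"
    using uv(1-3) bij_betw_imp_inj_on [OF bij_betw_vec_poly] by (metis inj_onD)
  then have "p \<noteq> 0" unfolding p_def by simp
  moreover have "\<forall>i\<ge>Suc m. coeff p i = 0" using uv(1,2) by (simp add: p_def coeff_vec_poly)
  ultimately have "degree p < Suc m" unfolding coeff_bounded_iff_degree by simp
  moreover have "ev x p = 0" unfolding p_def by (simp add: ev_hom uv(4))
  ultimately show ?thesis using \<open>p \<noteq> 0\<close> by auto
qed

lemma is_min_poly_iff:
  "is_min_poly \<iota> x p \<longleftrightarrow> lead_coeff p = 1 \<and> ev x p = 0 \<and> (\<forall>q. q \<noteq> 0 \<and> ev x q = 0 \<longrightarrow> degree p \<le> degree q)"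
  unfolding is_min_poly_def ev_def [symmetric] using monic_multiple_root
  by (metis leading_coeff_0_iff one_neq_zero)

lemma min_poly: "is_min_poly \<iota> x (min_poly \<iota> x)"
  unfolding min_poly_def
proof (rule theI')
  obtain p where p: "lead_coeff p = 1 \<and> ev x p = 0"
    using ex_annihilator monic_multiple_root by metis
  define p0 where "p0 = (ARG_MIN degree p. lead_coeff p = 1 \<and> ev x p = 0)"
  have "is_min_poly \<iota> x p0"
    unfolding is_min_poly_def ev_def [symmetric] p0_def
    using arg_min_nat_lemma [of "\<lambda>p. lead_coeff p = 1 \<and> ev x p = 0", OF p, of degree] by blast
  moreover have "p = q" if "is_min_poly \<iota> x p" "is_min_poly \<iota> x q" for p q
  proof (rule ccontr)
    assume "p \<noteq> q"
    from that have deg: "degree p = degree q" "lead_coeff p = 1" "lead_coeff q = 1"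
      and ev: "ev x (p - q) = 0"
      unfolding is_min_poly_def ev_def [symmetric] by (auto intro: antisym simp: ev_hom)
    have "degree p \<le> degree (p - q)"
      using that(1) \<open>p \<noteq> q\<close> ev unfolding is_min_poly_iff by simp
    \<comment> \<open>For constant \<open>p\<close> the degree of the difference could not drop,
      since \<open>degree 0 = 0\<close>; this case is excluded separately.\<close>
    moreover have "degree p > 0"
    proof (rule ccontr)
      assume "\<not> degree p > 0"
      then have "p = [:1:]" "q = [:1:]"
        using deg by (metis degree_eq_zeroE coeff_pCons_0 gr0I lead_coeff_pCons(2))+
      then show False using \<open>p \<noteq> q\<close> by simp
    qed
    moreover have "degree (p - q) < degree p \<or> degree (p - q) = 0"
    proof -
      have "coeff (p - q) (degree p) = 0" using deg by simp
      moreover have "degree (p - q) \<le> degree p"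
        using deg(1) by (intro degree_diff_le) simp_all
      ultimately show ?thesis
        using \<open>p \<noteq> q\<close> by (metis eq_iff_diff_eq_0 leading_coeff_0_iff le_neq_implies_less)
    qed
    ultimately show False by linarith
  qed
  ultimately show "\<exists>!p. is_min_poly \<iota> x p" by blast
qed

lemma lead_coeff_min_poly: "lead_coeff (min_poly \<iota> x) = 1"
  and ev_min_poly: "ev x (min_poly \<iota> x) = 0"
  and degree_min_poly_le: "q \<noteq> 0 \<Longrightarrow> ev x q = 0 \<Longrightarrow> degree (min_poly \<iota> x) \<le> degree q"
  using min_poly [of x] unfolding is_min_poly_iff by auto

lemma min_poly_nonzero: "min_poly \<iota> x \<noteq> 0"
  using lead_coeff_min_poly [of x] by auto

lemma min_poly_dvd_iff: "min_poly \<iota> x dvd q \<longleftrightarrow> ev x q = 0"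
proof
  assume "min_poly \<iota> x dvd q"
  then show "ev x q = 0" by (auto simp: dvd_def ev_hom ev_min_poly)
next
  assume q: "ev x q = 0"
  define r where "r = q mod min_poly \<iota> x"
  have "ev x q = ev x (q div min_poly \<iota> x * min_poly \<iota> x + r)"
    unfolding r_def div_mult_mod_eq ..
  then have "ev x r = 0" unfolding q by (simp add: ev_hom ev_min_poly)
  then have "r = 0"
    using degree_min_poly_le [of r x] degree_mod_less [OF min_poly_nonzero, of q x] unfolding r_def
    by linarith
  then show "min_poly \<iota> x dvd q" unfolding r_def by (simp add: mod_eq_0_iff_dvd)
qed

lemma degree_min_poly_upper: "degree (min_poly \<iota> x) \<le> m"
  using ex_annihilator degree_min_poly_le by (meson le_trans)

lemma card_conjugates:
  fixes x :: 'f
  assumes "\<And>t. 0 < t \<Longrightarrow> t < m \<Longrightarrow> x ^ (3 ^ t) \<noteq> x"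
  shows "card ((\<lambda>j. x ^ (3 ^ j)) ` {..<m}) = m"
proof -
  have "inj_on (\<lambda>j. x ^ (3 ^ j)) {..<m}"
  proof (rule linorder_inj_onI)
    fix i j assume ij: "i < j" "i \<in> {..<m}" "j \<in> {..<m}"
    show "x ^ (3 ^ i) \<noteq> x ^ (3 ^ j)"
    proof
      assume "x ^ (3 ^ i) = x ^ (3 ^ j)"
      also have "(3 :: nat) ^ j = 3 ^ (j - i) * 3 ^ i"
        using ij(1) by (simp add: power_add [symmetric])
      also have "x ^ (3 ^ (j - i) * 3 ^ i) = (x ^ (3 ^ (j - i))) ^ (3 ^ i)" by (rule power_mult)
      finally have "x = x ^ (3 ^ (j - i))" by (rule frob_inj [OF char_3])
      moreover have "x ^ (3 ^ (j - i)) \<noteq> x" using ij by (intro assms) auto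
      ultimately show False by argo
    qed
  qed auto
  then show ?thesis by (simp add: card_image)
qed

text \<open>The m distinct conjugates of \<open>x\<close> are all roots, which matches the upper
  bound from the pigeonhole argument.\<close>

lemma degree_min_poly:
  assumes "\<And>t. 0 < t \<Longrightarrow> t < m \<Longrightarrow> x ^ (3 ^ t) \<noteq> x"
  shows "degree (min_poly \<iota> x) = m"
proof (rule antisym [OF degree_min_poly_upper])
  have "card ((\<lambda>j. x ^ (3 ^ j)) ` {..<m}) \<le> degree (min_poly \<iota> x)"
    by (intro card_ev_roots_le min_poly_nonzero) (auto simp: ev_frob ev_min_poly)
  then show "m \<le> degree (min_poly \<iota> x)" using card_conjugates [OF assms] by simp
qed

text \<open>Otherwise \<open>y\<close> would be one more root than the degree admits.\<close>

lemma ev_min_poly_nonconjugate: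
  assumes "\<And>t. 0 < t \<Longrightarrow> t < m \<Longrightarrow> x ^ (3 ^ t) \<noteq> x" and "\<And>j. y \<noteq> x ^ (3 ^ j)"
  shows "ev y (min_poly \<iota> x) \<noteq> 0"
proof
  assume y: "ev y (min_poly \<iota> x) = 0"
  have "card (insert y ((\<lambda>j. x ^ (3 ^ j)) ` {..<m})) \<le> degree (min_poly \<iota> x)"
    by (intro card_ev_roots_le min_poly_nonzero) (auto simp: ev_frob ev_min_poly y)
  moreover have "card (insert y ((\<lambda>j. x ^ (3 ^ j)) ` {..<m})) = Suc m"
    using assms(2) card_conjugates [OF assms(1)] by (subst card_insert_disjoint) auto
  ultimately show False using degree_min_poly_upper [of x] by simp
qed

end

section \<open>The code with zeros \<open>\<alpha>\<close> and \<open>\<alpha>\<^sup>e\<close>\<close>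

text \<open>The residue condition on \<open>m\<close> is passed on as \<open>odd m\<close>,
  \<open>even e\<close> and \<open>3 * h = m + 2\<close>; divisions are written as products.\<close>

locale theorem6_setting = ternary_extension \<iota> m for \<iota> :: "'k::field \<Rightarrow> 'f::field" and m +
  fixes \<alpha> :: 'f and e h n :: nat
  assumes gen: "generates_units \<alpha>" and m_gt_1: "m > 1" and odd_m: "odd m"
    and h: "3 * h = m + 2" and e: "2 * e = 3 ^ h + 5" and even_e: "even e"
  defines "n \<equiv> 3 ^ m - 1"
begin

lemma n_Suc: "Suc n = 3 ^ m"
  unfolding n_def by simp

lemma n_ge_8: "n \<ge> 8"
  using power_increasing [of 2 m "3 :: nat"] m_gt_1 n_Suc by simp

lemma two_m_le: "2 * m \<le> n"
proof -
  have "2 * m + 1 \<le> (3 :: nat) ^ m" by (induction m) auto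
  then show ?thesis using n_Suc by simp
qed

lemma alpha_nonzero: "\<alpha> \<noteq> 0"
proof -
  have "\<alpha> ^ 1 \<in> UNIV - {0}" using gen unfolding generates_units_def by blast
  then show ?thesis by simp
qed

lemma alpha_n: "\<alpha> ^ n = 1"
  using power_card_minus_1_eq_1 [OF fin_f alpha_nonzero] unfolding card_f n_def .

lemma alpha_mod: "\<alpha> ^ (i mod n) = \<alpha> ^ i"
proof -
  have "\<alpha> ^ i = \<alpha> ^ (n * (i div n) + i mod n)" by simp
  also have "\<dots> = (\<alpha> ^ n) ^ (i div n) * \<alpha> ^ (i mod n)" unfolding power_add power_mult ..
  finally show ?thesis by (simp add: alpha_n)
qed

lemma alpha_inj: "inj_on (\<lambda>i. \<alpha> ^ i) {..<n}"
proof (rule eq_card_imp_inj_on)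
  have "(\<lambda>i. \<alpha> ^ i) ` {..<n} = range (\<lambda>i. \<alpha> ^ i)"
  proof (intro equalityI subsetI)
    fix x assume "x \<in> range (\<lambda>i. \<alpha> ^ i)"
    then obtain i where "x = \<alpha> ^ (i mod n)" unfolding alpha_mod by blast
    then show "x \<in> (\<lambda>i. \<alpha> ^ i) ` {..<n}" using n_ge_8 by auto
  qed auto
  also have "\<dots> = UNIV - {0}" using gen unfolding generates_units_def .
  finally show "card ((\<lambda>i. \<alpha> ^ i) ` {..<n}) = card {..<n}"
    using fin_f by (simp add: card_Diff_singleton card_f n_def)
qed simp

lemma alpha_eq_iff: "\<alpha> ^ i = \<alpha> ^ j \<longleftrightarrow> i mod n = j mod n"
  using inj_on_eq_iff [OF alpha_inj, of "i mod n" "j mod n"] n_ge_8 by (simp add: alpha_mod)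

lemma alpha_eq_1_iff: "\<alpha> ^ i = 1 \<longleftrightarrow> n dvd i"
  using alpha_eq_iff [of i 0] by (simp add: mod_eq_0_iff_dvd)

lemma alpha_frob_iff: "(\<alpha> ^ i) ^ (3 ^ t) = \<alpha> ^ i \<longleftrightarrow> n dvd i * (3 ^ t - 1)"
proof -
  have "i * 3 ^ t = i * (3 ^ t - 1) + i" by (simp add: algebra_simps)
  then have "(\<alpha> ^ i) ^ (3 ^ t) = \<alpha> ^ (i * (3 ^ t - 1)) * \<alpha> ^ i"
    by (simp add: power_mult [symmetric] power_add [symmetric])
  then show ?thesis using alpha_nonzero by (simp add: alpha_eq_1_iff)
qed

lemma alpha_frob: "0 < t \<Longrightarrow> t < m \<Longrightarrow> (\<alpha> ^ 1) ^ (3 ^ t) \<noteq> \<alpha> ^ 1"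
proof
  assume t: "0 < t" "t < m" and "(\<alpha> ^ 1) ^ (3 ^ t) = \<alpha> ^ 1"
  then have "n dvd 3 ^ t - 1" unfolding alpha_frob_iff by simp
  moreover have "1 < (3 :: nat) ^ t" using t(1) by (intro one_less_power) auto
  ultimately have "n \<le> 3 ^ t - 1" by (intro dvd_imp_le) auto
  moreover have "(3 :: nat) ^ t < 3 ^ m" using t(2) by (intro power_strict_increasing) auto
  ultimately show False using \<open>1 < 3 ^ t\<close> unfolding n_def by linarith
qed

lemma alpha_e_frob: "0 < t \<Longrightarrow> t < m \<Longrightarrow> (\<alpha> ^ e) ^ (3 ^ t) \<noteq> \<alpha> ^ e"
  using exponent_not_in_subfield [OF odd_m h e] unfolding alpha_frob_iff n_def by blast

text \<open>Parity survives reduction modulo the even number \<open>n\<close>; \<open>e\<close> is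
  even and every power of 3 is odd.\<close>

lemma alpha_e_nonconjugate: "\<alpha> ^ e \<noteq> (\<alpha> ^ 1) ^ (3 ^ j)"
proof
  assume "\<alpha> ^ e = (\<alpha> ^ 1) ^ (3 ^ j)"
  then have "e mod n = 3 ^ j mod n" by (simp add: alpha_eq_iff)
  moreover have "even n" unfolding n_def by simp
  ultimately have "even e \<longleftrightarrow> even ((3 :: nat) ^ j)" by (metis dvd_mod_iff)
  then show False using even_e by simp
qed

section \<open>The generator polynomial and its zeros\<close>

definition g :: "'k poly" where
  "g = min_poly \<iota> (\<alpha> ^ 1) * min_poly \<iota> (\<alpha> ^ e)"

text \<open>The first minimal polynomial does not vanish at \<open>\<alpha> ^ e\<close>, so that
  zero survives division by it.\<close>

lemma g_dvd_iff: "g dvd q \<longleftrightarrow> ev \<alpha> q = 0 \<and> ev (\<alpha> ^ e) q = 0"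
proof
  assume "g dvd q"
  then have "min_poly \<iota> (\<alpha> ^ 1) dvd q" "min_poly \<iota> (\<alpha> ^ e) dvd q"
    unfolding g_def by (auto intro: dvd_mult_left dvd_mult_right)
  then show "ev \<alpha> q = 0 \<and> ev (\<alpha> ^ e) q = 0" unfolding min_poly_dvd_iff by simp
next
  assume q: "ev \<alpha> q = 0 \<and> ev (\<alpha> ^ e) q = 0"
  then obtain r where r: "q = min_poly \<iota> (\<alpha> ^ 1) * r"
    using min_poly_dvd_iff [of "\<alpha> ^ 1" q] by (auto simp: dvd_def)
  then have "ev (\<alpha> ^ e) r = 0"
    using q ev_min_poly_nonconjugate [OF alpha_frob alpha_e_nonconjugate] by (auto simp: ev_hom)
  then show "g dvd q" unfolding g_def r min_poly_dvd_iff [symmetric] by (intro mult_dvd_mono) auto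
qed

lemma lead_coeff_g: "lead_coeff g = 1"
  unfolding g_def by (simp add: lead_coeff_mult lead_coeff_min_poly)

lemma degree_g: "degree g = 2 * m"
  unfolding g_def using min_poly_nonzero
  by (simp add: degree_mult_eq degree_min_poly [OF alpha_frob, simplified] degree_min_poly [OF alpha_e_frob])

lemma g_dvd: "g dvd monom 1 n - 1"
  unfolding g_dvd_iff by (simp add: ev_hom alpha_n power_mult [symmetric] mult.commute [of e])
    (simp add: power_mult alpha_n)

lemma exponent_code_eq: "exponent_code \<iota> \<alpha> m [1, e] = principal_cyclic_code n g"
proof -
  have "(\<Prod>i\<leftarrow>[1, e]. min_poly \<iota> (\<alpha> ^ i)) = g" unfolding g_def by simp
  then show ?thesis
    unfolding exponent_code_def n_def [symmetric]
    using cyclic_code_eq_principal [OF lead_coeff_g g_dvd] n_ge_8 by simp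
qed

lemma mem_code_iff:
  "c \<in> principal_cyclic_code n g \<longleftrightarrow> c \<in> carrier_vec n \<and>
    (\<Sum>i<n. \<iota> (c $ i) * \<alpha> ^ i) = 0 \<and> (\<Sum>i<n. \<iota> (c $ i) * (\<alpha> ^ e) ^ i) = 0"
  unfolding mem_principal_cyclic_code_iff [OF g_dvd] g_dvd_iff ev_vec_poly by auto

lemma card_code: "card (principal_cyclic_code n g) = 3 ^ (n - 2 * m)"
  using card_principal_cyclic_code [OF fin_k lead_coeff_g g_dvd] two_m_le
  by (simp add: degree_g card_k)

section \<open>Minimum distance and optimality\<close>

lemma four_le_hamming_dist:
  assumes u: "u \<in> principal_cyclic_code n g" and v: "v \<in> principal_cyclic_code n g" and "u \<noteq> v"
  shows "4 \<le> hamming_dist u v"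
proof (rule ccontr)
  assume less: "\<not> 4 \<le> hamming_dist u v"
  define S where "S = {i. i < n \<and> u $ i \<noteq> v $ i}"
  define \<epsilon> where "\<epsilon> i = \<iota> (u $ i - v $ i)" for i
  \<comment> \<open>The signs are absorbed into \<open>x\<close>, so that the first check equation
    becomes a sum equal to zero.\<close>
  define x where "x i = \<epsilon> i * \<alpha> ^ i" for i
  have uv: "u \<in> carrier_vec n" "v \<in> carrier_vec n" using u v unfolding mem_code_iff by auto
  have fin: "finite S" unfolding S_def by simp
  have "S \<noteq> {}" using \<open>u \<noteq> v\<close> uv unfolding S_def by auto
  have "card S < 4" using less uv(1) unfolding hamming_dist_def S_def by simp
  have \<epsilon>: "\<epsilon> i = 1 \<or> \<epsilon> i = - 1" if "i \<in> S" for i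
    using that unfolding S_def \<epsilon>_def by (intro hom_k_cases) simp
  have x_nonzero: "x i \<noteq> 0" if "i \<in> S" for i
    using \<epsilon> [OF that] alpha_nonzero unfolding x_def by auto
  have syndrome: "(\<Sum>i\<in>S. \<epsilon> i * y ^ i) = 0"
    if "(\<Sum>i<n. \<iota> (u $ i) * y ^ i) = 0" "(\<Sum>i<n. \<iota> (v $ i) * y ^ i) = 0" for y
  proof -
    have "(\<Sum>i\<in>S. \<epsilon> i * y ^ i) = (\<Sum>i<n. \<epsilon> i * y ^ i)"
      unfolding S_def \<epsilon>_def by (intro sum.mono_neutral_left) auto
    also have "\<dots> = 0"
      using that by (simp add: \<epsilon>_def hom_distribs left_diff_distrib sum_subtractf)
    finally show ?thesis .
  qed
  have sum_x: "(\<Sum>i\<in>S. x i) = 0"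
    unfolding x_def using u v unfolding mem_code_iff by (intro syndrome) auto
  \<comment> \<open>Evenness of \<open>e\<close> removes the sign inside the power; the second check
    equation keeps its sign outside.\<close>
  have "x i ^ e = (\<alpha> ^ e) ^ i" if "i \<in> S" for i
    using \<epsilon> [OF that] even_e unfolding x_def by (auto simp: power_mult [symmetric] mult.commute power_mult_distrib)
  moreover have "(\<Sum>i\<in>S. \<epsilon> i * (\<alpha> ^ e) ^ i) = 0"
    using u v unfolding mem_code_iff by (intro syndrome) auto
  ultimately have sum_xe: "(\<Sum>i\<in>S. \<epsilon> i * x i ^ e) = 0" by simp
  have distinct: "x i \<noteq> x j" if "i \<in> S" "j \<in> S" "i \<noteq> j" "\<epsilon> i = \<epsilon> j" for i j
    using that \<epsilon> [OF that(1)] inj_on_eq_iff [OF alpha_inj, of i j] unfolding x_def S_def by auto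
  have signs: "A + B = C \<or> A + B = - C"
    if "a * A + a * B + c * C = 0" "a = 1 \<or> a = - 1" "c = 1 \<or> c = - 1" for a c A B C :: 'f
  proof -
    have "A + B = a * (a * A + a * B + c * C) - a * c * C"
      using that(2) by (elim disjE) simp_all
    then have "A + B = - (a * c * C)" using that(1) by simp
    then show ?thesis using that(2,3) by (elim disjE) simp_all
  qed
  have no_triple: False if "S = {i, j, l}" "i \<noteq> j" "i \<noteq> l" "j \<noteq> l" "\<epsilon> i = \<epsilon> j" for i j l
  proof -
    have "x i + x j + x l = 0" using sum_x that by (simp add: add.assoc)
    moreover have "\<epsilon> i * x i ^ e + \<epsilon> j * x j ^ e + \<epsilon> l * x l ^ e = 0"
      using sum_xe that by (simp add: add.assoc)
    then have "\<epsilon> i * x i ^ e + \<epsilon> i * x j ^ e + \<epsilon> l * x l ^ e = 0" using that(5) by simp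
    then have "x i ^ e + x j ^ e = x l ^ e \<or> x i ^ e + x j ^ e = - (x l ^ e)"
      by (rule signs) (use \<epsilon> that(1) in blast)+
    ultimately have "x i = x j"
      using power_sum_imp_eq [OF char_3 frob_m odd_m h e] x_nonzero that(1) by blast
    then show False using distinct [of i j] that by simp
  qed
  have "card S \<noteq> 0" using \<open>S \<noteq> {}\<close> fin by simp
  with \<open>card S < 4\<close> consider "card S = 1" | "card S = 2" | "card S = 3" by linarith
  then show False
  proof cases
    case 1
    then obtain i where "S = {i}" by (auto simp: card_1_singleton_iff)
    then show False using sum_x x_nonzero by simp
  next
    case 2
    then obtain i j where S: "S = {i, j}" "i \<noteq> j" by (auto simp: card_2_iff)
    \<comment> \<open>Equal e-th powers force opposite signs, which cancel in this equation and
      leave equal powers of \<open>\<alpha>\<close>.\<close>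
    have neg: "x i = - x j" using sum_x S by (simp add: eq_neg_iff_add_eq_0)
    then have "x i ^ e = x j ^ e" using even_e by simp
    then have "\<epsilon> i = - \<epsilon> j"
      using sum_xe S x_nonzero [of j] by (simp add: distrib_right [symmetric] eq_neg_iff_add_eq_0)
    then have "\<alpha> ^ i = \<alpha> ^ j" using neg \<epsilon> [of j] S unfolding x_def by auto
    then show False using S inj_on_eq_iff [OF alpha_inj, of i j] unfolding S_def by auto
  next
    case 3
    then obtain i j l where S: "S = {i, j, l}" "i \<noteq> j" "i \<noteq> l" "j \<noteq> l"
      by (auto simp: card_3_iff)
    \<comment> \<open>Among three signs two agree.\<close>
    then consider "\<epsilon> i = \<epsilon> j" | "\<epsilon> i = \<epsilon> l" | "\<epsilon> j = \<epsilon> l"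
      using \<epsilon> [of i] \<epsilon> [of j] \<epsilon> [of l] by auto
    then show False
      by cases (use no_triple [of i j l] no_triple [of i l j] no_triple [of j l i] S in auto)
  qed
qed

lemma ex_close_words:
  fixes C :: "'k vec set"
  assumes "C \<subseteq> carrier_vec n" "card C = 3 ^ (n - 2 * m)"
  shows "\<exists>u\<in>C. \<exists>v\<in>C. u \<noteq> v \<and> hamming_dist u v < 5"
  using sphere_packing [OF card_k n_def [THEN meta_eq_to_obj_eq] _ assms two_m_le] n_ge_8 by simp

lemma linear_code_exponent_code: "linear_code n (n - 2 * m) 4 (exponent_code \<iota> \<alpha> m [1, e])"
proof -
  let ?C = "principal_cyclic_code n g"
  have sub: "VectorSpace.subspace class_ring ?C (module_vec TYPE('k) n)"
    by (rule subspace_principal_cyclic_code [OF g_dvd])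
  have "(3 :: nat) ^ vectorspace.dim class_ring ((module_vec TYPE('k) n)\<lparr>carrier := ?C\<rparr>) = 3 ^ (n - 2 * m)"
    using card_subspace_vec [OF fin_k sub] unfolding card_code card_k by simp
  then have dim: "vectorspace.dim class_ring ((module_vec TYPE('k) n)\<lparr>carrier := ?C\<rparr>) = n - 2 * m"
    by simp
  have "?C \<subseteq> carrier_vec n" unfolding principal_cyclic_code_def by blast
  \<comment> \<open>Sphere packing also supplies words attaining distance 4.\<close>
  then obtain u v where "u \<in> ?C" "v \<in> ?C" "u \<noteq> v" "hamming_dist u v < 5"
    using ex_close_words [OF _ card_code] by blast
  moreover from this have "hamming_dist u v = 4" using four_le_hamming_dist [of u v] by simp
  ultimately have "has_min_dist ?C 4"
    unfolding has_min_dist_def using four_le_hamming_dist by blast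
  with sub dim show ?thesis unfolding linear_code_def exponent_code_eq by blast
qed

lemma linear_code_min_dist_le_4:
  fixes C :: "'k vec set"
  assumes "linear_code n (n - 2 * m) d C"
  shows "d \<le> 4"
proof -
  from assms have sub: "VectorSpace.subspace class_ring C (module_vec TYPE('k) n)"
    and dim: "vectorspace.dim class_ring ((module_vec TYPE('k) n)\<lparr>carrier := C\<rparr>) = n - 2 * m"
    and d: "\<And>u v. u \<in> C \<Longrightarrow> v \<in> C \<Longrightarrow> u \<noteq> v \<Longrightarrow> d \<le> hamming_dist u v"
    unfolding linear_code_def has_min_dist_def by auto
  have "card C = 3 ^ (n - 2 * m)"
    using card_subspace_vec [OF fin_k sub] unfolding dim card_k .
  moreover have "C \<subseteq> carrier_vec n"
    using sub unfolding VectorSpace.subspace_def submodule_def by (simp add: module_vec_simps)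
  ultimately obtain u v where "u \<in> C" "v \<in> C" "u \<noteq> v" "hamming_dist u v < 5"
    using ex_close_words by blast
  then show ?thesis using d [of u v] by simp
qed

lemma optimal_code_exponent_code: "optimal_code n (n - 2 * m) 4 (exponent_code \<iota> \<alpha> m [1, e])"
  unfolding optimal_code_def
  using linear_code_exponent_code linear_code_min_dist_le_4 by (metis leD)

end

theorem theorem6:
  fixes \<iota> :: "'k::field \<Rightarrow> 'f::field"
    and \<alpha> :: 'f
    and m e :: nat
  assumes "CARD('k) = 3"
    and "CARD('f) = 3 ^ m"
    and "field_hom \<iota>"
    and "generates_units \<alpha>"
    and "m > 1"
    and "[m = 1] (mod 6)"
    and "e = (3 ^ ((m + 2) div 3) + 5) div 2"
  shows "linear_code (3 ^ m - 1) (3 ^ m - 1 - 2 * m) 4 (exponent_code \<iota> \<alpha> m [1, e])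
    \<and> optimal_code (3 ^ m - 1) (3 ^ m - 1 - 2 * m) 4 (exponent_code \<iota> \<alpha> m [1, e])"
proof -
  define j where "j = m div 6"
  have m: "m = 6 * j + 1"
    using assms(6) unfolding j_def cong_def by presburger
  define h where "h = 2 * j + 1"
  have h: "3 * h = m + 2" "(m + 2) div 3 = h" unfolding h_def m by simp_all
  \<comment> \<open>As \<open>h\<close> is odd, 3^h is 3 modulo 4, so 4 divides 3^h + 5 and
    \<open>e\<close> is even.\<close>
  have "(3 :: nat) ^ h = 9 ^ j * 3" unfolding h_def by (simp add: power_mult)
  moreover have "(9 :: nat) ^ j mod 4 = 1" by (induction j) (simp_all add: mod_mult_right_eq [symmetric])
  ultimately have "(3 ^ h + 5) mod 4 = (0 :: nat)" by presburger
  then have e: "2 * e = 3 ^ h + 5" "even e" unfolding assms(7) h(2) by presburger+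
  interpret field_hom \<iota> by (rule assms(3))
  interpret theorem6_setting \<iota> m \<alpha> e h "3 ^ m - 1"
    by unfold_locales (use assms(1,2,4,5) m h(1) e in auto)
  show ?thesis using linear_code_exponent_code optimal_code_exponent_code by blast
qed

end
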